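(* Let $R\cong R_1\times R_2\times\cdots\times R_n$ with $n\ge 2$ be a finite non-local commutative ring with unity, where each $R_i$ is a local ring, and suppose $U''(R)\neq\emptyset$. Then: (i) If $n\ge 3$, then $\mathrm{sdim}(\mathrm{Cl}_2(R))=(2^n-1)|U(R)|-2^n$. (ii) If $n=2$ and $R$ is isomorphic to one of the rings $\mathbb{F}_4\times\mathbb{Z}_2$, $\mathbb{Z}_5\times\mathbb{Z}_2$, $\mathbb{Z}_2[x]/\langle x^3\rangle\times\mathbb{Z}_2$, $\mathbb{Z}_4[x]/\langle 2x,x^2-2\rangle\times\mathbb{Z}_2$, then $\mathrm{sdim}(\mathrm{Cl}_2(R))=3|U(R)|-5$. (iii) If $n=2$ and $R$ is not isomorphic to any of the rings listed in (ii), then $\mathrm{sdim}(\mathrm{Cl}_2(R))=3|U(R)|-6$.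
   Context: $U(R)$ is the set of units, $U'(R)=\{u\in U(R):u^2=1\}$, $U''(R)=U(R)\setminus U'(R)$, $\mathrm{Id}(R)$ the set of idempotents. $\mathbb{F}_4$ is the field with four elements. The clean graph $\mathrm{Cl}(R)$ has vertex set $\{(e,u): e\in\mathrm{Id}(R), u\in U(R)\}$, two distinct vertices $(e,u),(f,v)$ being adjacent iff $ef=0$ or $uv=1$; $\mathrm{Cl}_2(R)$ is its subgraph induced by the vertices with $e\neq 0$. In a graph, a vertex $w$ strongly resolves vertices $x,y$ if some shortest $x$–$w$ path contains $y$ or some shortest $y$–$w$ path contains $x$; a strong resolving set is a set $S$ of vertices such that every two distinct vertices are strongly resolved by some vertex of $S$; $\mathrm{sdim}$ is the smallest cardinality of a strong resolving set. *)

theory Defs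
  imports
    "HOL-Algebra.Algebra"
    "HOL-Number_Theory.Residues"
    "Graph_Theory.Graph_Theory"
begin

no_notation vwalk_join (infixr \<open>\<oplus>\<close> 65)

definition local_ring :: "('a, 'm) ring_scheme \<Rightarrow> bool" where
  "local_ring R \<longleftrightarrow> cring R \<and> (\<exists>!M. maximalideal M R)"

definition idempotents :: "('a, 'm) ring_scheme \<Rightarrow> 'a set" where
  "idempotents R = {e \<in> carrier R. e \<otimes>\<^bsub>R\<^esub> e = e}"

definition units_sq_one :: "('a, 'm) ring_scheme \<Rightarrow> 'a set" where
  "units_sq_one R = {u \<in> Units R. u [^]\<^bsub>R\<^esub> (2::nat) = \<one>\<^bsub>R\<^esub>}"

definition units_sq_not_one :: "('a, 'm) ring_scheme \<Rightarrow> 'a set" where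
  "units_sq_not_one R = Units R - units_sq_one R"

text \<open>An undirected simple graph is encoded as a symmetric loop-free digraph.\<close>

definition clean_graph :: "('a, 'm) ring_scheme \<Rightarrow> ('a \<times> 'a) pair_pre_digraph" where
  "clean_graph R =
     \<lparr> pverts = idempotents R \<times> Units R,
       parcs = {((e, u), (f, v)) | e u f v.
         (e, u) \<in> idempotents R \<times> Units R \<and> (f, v) \<in> idempotents R \<times> Units R \<and>
         (e, u) \<noteq> (f, v) \<and> (e \<otimes>\<^bsub>R\<^esub> f = \<zero>\<^bsub>R\<^esub> \<or> u \<otimes>\<^bsub>R\<^esub> v = \<one>\<^bsub>R\<^esub>)} \<rparr>"

definition clean_graph2 ::
    "('a, 'm) ring_scheme \<Rightarrow> ('a \<times> 'a, ('a \<times> 'a) \<times> ('a \<times> 'a)) pre_digraph" where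
  "clean_graph2 R =
     with_proj (clean_graph R) \<restriction> {(e, u). (e, u) \<in> pverts (clean_graph R) \<and> e \<noteq> \<zero>\<^bsub>R\<^esub>}"

definition shortest_vpath :: "('v, 'e) pre_digraph \<Rightarrow> 'v \<Rightarrow> 'v \<Rightarrow> 'v list \<Rightarrow> bool" where
  "shortest_vpath G x y p \<longleftrightarrow>
     vpath p G \<and> hd p = x \<and> last p = y \<and>
     (\<forall>q. vpath q G \<and> hd q = x \<and> last q = y \<longrightarrow> vwalk_length p \<le> vwalk_length q)"

definition strongly_resolves :: "('v, 'e) pre_digraph \<Rightarrow> 'v \<Rightarrow> 'v \<Rightarrow> 'v \<Rightarrow> bool" where
  "strongly_resolves G w x y \<longleftrightarrow>
     (\<exists>p. shortest_vpath G x w p \<and> y \<in> set p) \<or> (\<exists>p. shortest_vpath G y w p \<and> x \<in> set p)"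

definition strong_resolving_set :: "('v, 'e) pre_digraph \<Rightarrow> 'v set \<Rightarrow> bool" where
  "strong_resolving_set G S \<longleftrightarrow>
     S \<subseteq> verts G \<and>
     (\<forall>x \<in> verts G. \<forall>y \<in> verts G. x \<noteq> y \<longrightarrow> (\<exists>w \<in> S. strongly_resolves G w x y))"

definition sdim :: "('v, 'e) pre_digraph \<Rightarrow> nat" where
  "sdim G = (LEAST k. \<exists>S. finite S \<and> strong_resolving_set G S \<and> card S = k)"

text \<open>In \<open>F4\<close> the pair \<open>(a, b)\<close> stands for \<open>a + b \<omega>\<close> over the field with two elements, where
  \<open>\<omega>\<^sup>2 = \<omega> + 1\<close>; addition of bits is exclusive or, that is, \<open>\<noteq>\<close>.\<close>

definition F4 :: "(bool \<times> bool) ring" where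
  "F4 = \<lparr> carrier = UNIV,
      monoid.mult = (\<lambda>(a, b) (c, d). ((a \<and> c) \<noteq> (b \<and> d), ((a \<and> d) \<noteq> (b \<and> c)) \<noteq> (b \<and> d))),
      monoid.one = (True, False),
      ring.zero = (False, False),
      ring.add = (\<lambda>(a, b) (c, d). (a \<noteq> c, b \<noteq> d)) \<rparr>"

lemma field_F4: "field F4"
proof -
  have "x \<oplus>\<^bsub>F4\<^esub> x = \<zero>\<^bsub>F4\<^esub>" for x
    by (cases x) (simp add: F4_def)
  then have "\<exists>y \<in> carrier F4. y \<oplus>\<^bsub>F4\<^esub> x = \<zero>\<^bsub>F4\<^esub>" if "x \<in> carrier F4" for x
    using that by blast
  then have "abelian_group F4"
    by (intro abelian_groupI) (simp_all add: F4_def split_paired_all, argo+)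
  moreover have "comm_monoid F4"
    by (rule comm_monoidI) (simp_all add: F4_def split_paired_all, argo+)
  moreover have "(x \<oplus>\<^bsub>F4\<^esub> y) \<otimes>\<^bsub>F4\<^esub> z = x \<otimes>\<^bsub>F4\<^esub> z \<oplus>\<^bsub>F4\<^esub> y \<otimes>\<^bsub>F4\<^esub> z" for x y z
    by (cases x; cases y; cases z) (simp add: F4_def, argo)
  ultimately have "cring F4"
    by (intro cringI)
  moreover have "x \<in> Units F4 \<longleftrightarrow> x \<noteq> \<zero>\<^bsub>F4\<^esub>" for x
    by (cases x) (simp add: F4_def Units_def ex_bool_eq, argo)
  then have "Units F4 = carrier F4 - {\<zero>\<^bsub>F4\<^esub>}"
    by (auto simp: F4_def)
  ultimately show ?thesis
    by (rule cring.cring_fieldI)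
qed

lemma card_F4: "card (carrier F4) = 4"
  by (simp add: F4_def flip: UNIV_Times_UNIV)

definition Z2_X_mod_X3 :: "(nat \<Rightarrow> int) set ring" where
  "Z2_X_mod_X3 = (let P = UP (residue_ring 2) in P Quot (Idl\<^bsub>P\<^esub> {up_ring.monom P 1 3}))"

definition Z4_X_mod_2X_X2_minus_2 :: "(nat \<Rightarrow> int) set ring" where
  "Z4_X_mod_2X_X2_minus_2 =
     (let P = UP (residue_ring 4) in
        P Quot (Idl\<^bsub>P\<^esub> {up_ring.monom P 2 1, up_ring.monom P 1 2 \<ominus>\<^bsub>P\<^esub> up_ring.monom P 2 0}))"

definition exceptional_ring :: "('a, 'm) ring_scheme \<Rightarrow> bool" where
  "exceptional_ring R \<longleftrightarrow>
     R \<simeq> RDirProd F4 (residue_ring 2) \<or>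
     R \<simeq> RDirProd (residue_ring 5) (residue_ring 2) \<or>
     R \<simeq> RDirProd Z2_X_mod_X3 (residue_ring 2) \<or>
     R \<simeq> RDirProd Z4_X_mod_2X_X2_minus_2 (residue_ring 2)"

end

theory Submission
  imports Defs
begin

text \<open>
  Two vertices are mutually maximally distant (mmd) if neither has a neighbour further away from the
  other. Every geodesic extends to one between mmd vertices, and an mmd pair is strongly resolved
  only by its own members; hence the strong resolving sets are the vertex covers of the mmd relation,
  and the strong metric dimension is the number of vertices minus the largest size of a set without
  mmd pairs.

  In the clean graph all distances are at most 3, with 3 attained only between \<open>(1, u)\<close> and \<open>(1, v)\<close>.
  For \<open>e, f\<close> different from 0 and 1 this gives: \<open>(1, u), (1, v)\<close> is mmd iff \<open>v \<noteq> u, u\<inverse>\<close>;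
  \<open>(e, u), (1, v)\<close> is mmd iff \<open>v = u\<close> and \<open>u\<^sup>2 \<noteq> 1\<close>; and \<open>(e, u), (f, v)\<close> is mmd iff
  \<open>ef \<noteq> 0\<close> and \<open>uv \<noteq> 1\<close>. A set without mmd pairs thus consists of at most two vertices
  \<open>(1, u), (1, u\<inverse>)\<close> and a clique on the remaining idempotents. With \<open>2\<^sup>n > 4\<close> idempotents such a
  clique has at most \<open>2\<^sup>n - 2\<close> elements, and the maximum \<open>2\<^sup>n\<close> is attained. With four idempotents the
  clique has at most 4 elements, and the total 6 is attained iff more than two units have
  \<open>u\<^sup>2 \<noteq> 1\<close>; otherwise the maximum is 5.

  For a product of two finite local rings, exactly two units satisfy \<open>u\<^sup>2 \<noteq> 1\<close> iff one factor has
  trivial unit group, hence is \<open>\<int>/2\<close>, and the unit group of the other is cyclic of order 3 or 4.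
  Comparing the number of units with the size of the maximal ideal leaves only the four listed rings.
\<close>

section \<open>Distances and the strong metric dimension\<close>

text \<open>The assumptions are local conditions that force \<open>d\<close> to be the graph distance, so that an
  explicit formula for \<open>d\<close> can be verified without considering walks.\<close>

locale graph_distance =
  fixes G :: "('v, 'e) pre_digraph" and d :: "'v \<Rightarrow> 'v \<Rightarrow> nat"
  assumes finite_verts: "finite (verts G)"
    and arcs_ends_verts: "(x, y) \<in> arcs_ends G \<Longrightarrow> x \<in> verts G \<and> y \<in> verts G"
    and d_sym: "x \<in> verts G \<Longrightarrow> y \<in> verts G \<Longrightarrow> d x y = d y x"
    and d_eq_0: "x \<in> verts G \<Longrightarrow> y \<in> verts G \<Longrightarrow> d x y = 0 \<longleftrightarrow> x = y"
    and d_step: "(x, y) \<in> arcs_ends G \<Longrightarrow> z \<in> verts G \<Longrightarrow> d x z \<le> Suc (d y z)"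
    and d_pred: "x \<in> verts G \<Longrightarrow> z \<in> verts G \<Longrightarrow> d x z = Suc k \<Longrightarrow>
      \<exists>y. (x, y) \<in> arcs_ends G \<and> d y z = k"
begin

text \<open>By induction along the walk, each arc lowers the distance to the end by at most 1
  (\<open>d_step\<close>). The bound is stated for every vertex of the walk, not only its head,
  because excluding repeated vertices needs it.\<close>

lemma d_le_walk:
  assumes "vwalk p G" "y \<in> set p"
  shows "d y (last p) \<le> length p - 1"
  using assms
proof (induction p arbitrary: y rule: list.induct)
  case (Cons u q)
  show ?case
  proof (cases "q = []")
    case True
    then show ?thesis
      using Cons.prems by (auto simp: vwalk_def d_eq_0)
  next
    case False
    then have arc: "(u, hd q) \<in> arcs_ends G" and w: "vwalk q G"
      using Cons.prems(1) by (auto elim: vwalk_consE)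
    have last: "last q \<in> verts G"
      using w last_in_set[OF False] unfolding vwalk_def by blast
    have "d y (last q) \<le> length q"
    proof (cases "y = u")
      case True
      then show ?thesis
        using d_step[OF arc last] Cons.IH[OF w, of "hd q"] False by (cases q) auto
    next
      case False
      then show ?thesis using Cons.IH[OF w, of y] Cons.prems(2) by simp
    qed
    then show ?thesis using False by simp
  qed
qed simp

lemma triangle:
  assumes "x \<in> verts G" "y \<in> verts G" "z \<in> verts G"
  shows "d x z \<le> d x y + d y z"
  using assms
proof (induction "d x y" arbitrary: x)
  case 0
  then show ?case using d_eq_0 by fastforce
next
  case (Suc k)
  then obtain t where t: "(x, t) \<in> arcs_ends G" "d t y = k"
    using d_pred by metis
  then have "d t z \<le> d t y + d y z"
    using Suc arcs_ends_verts by blast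
  then show ?case using d_step[OF t(1) Suc.prems(3)] t Suc by simp
qed

text \<open>On a walk of minimal length, every vertex after the head is strictly nearer to the end
  than the head, so the head does not recur. This is why minimal walks are already paths.\<close>

lemma geodesic_walk_distinct:
  assumes "vwalk p G" "length p = Suc (d (hd p) (last p))"
  shows "distinct p"
  using assms
proof (induction p rule: list.induct)
  case (Cons u q)
  show ?case
  proof (cases "q = []")
    case False
    then have arc: "(u, hd q) \<in> arcs_ends G" and w: "vwalk q G"
      using Cons.prems(1) by (auto elim: vwalk_consE)
    have last: "last q \<in> verts G"
      using w last_in_set[OF False] unfolding vwalk_def by blast
    have len: "length q = d u (last q)"
      using Cons.prems(2) False by simp
    have le: "Suc (d y (last q)) \<le> length q" if "y \<in> set q" for y
      using d_le_walk[OF w that] False by (cases q) auto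
    \<comment> \<open>The tail is again geodesic: it can be neither shorter than
      \<open>d_step\<close> allows nor, by \<open>le\<close>, longer than the distance from its own
      head.\<close>
    have "length q = Suc (d (hd q) (last q))"
      using d_step[OF arc last] len le[of "hd q"] False by simp
    then have "distinct q"
      using Cons.IH w by blast
    moreover have "u \<notin> set q"
      using le[of u] len by linarith
    ultimately show ?thesis by simp
  qed simp
qed simp

lemma ex_geodesic_walk:
  assumes "x \<in> verts G" "z \<in> verts G"
  shows "\<exists>p. vwalk p G \<and> hd p = x \<and> last p = z \<and> length p = Suc (d x z)"
  using assms
proof (induction "d x z" arbitrary: x)
  case 0
  then have "x = z" using d_eq_0 by metis
  then show ?case using 0 by (intro exI[of _ "[x]"]) (auto simp: vwalk_def)
next
  case (Suc k)
  then obtain y where y: "(x, y) \<in> arcs_ends G" "d y z = k"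
    using d_pred by metis
  then obtain p where p: "vwalk p G" "hd p = y" "last p = z" "length p = Suc (d y z)"
    using Suc arcs_ends_verts by blast
  have "vwalk (x # p) G"
    using p y Suc.prems by (intro vwalk_consI) auto
  moreover have "last (x # p) = z"
    using p by (auto simp: vwalk_def)
  ultimately show ?case
    using p y Suc by (intro exI[of _ "x # p"]) auto
qed

text \<open>Minimality among paths becomes an equation on length: a geodesic walk exists and is a
  path, and no path is shorter. The \<open>Suc\<close> appears because \<open>length\<close> counts
  vertices, not arcs.\<close>

lemma shortest_vpath_iff:
  assumes "x \<in> verts G" "z \<in> verts G"
  shows "shortest_vpath G x z p \<longleftrightarrow> vwalk p G \<and> hd p = x \<and> last p = z \<and> length p = Suc (d x z)"
    (is "_ \<longleftrightarrow> ?geo p")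
proof -
  have path: "vpath q G" if "?geo q" for q
    using that geodesic_walk_distinct[of q] by auto
  have le: "d x z \<le> length q - 1" if "vpath q G" "hd q = x" "last q = z" for q
    using d_le_walk[of q x] that by (auto simp: vpath_def vwalk_def)
  obtain q where q: "?geo q" using ex_geodesic_walk[OF assms] by blast
  show ?thesis
  proof
    assume p: "shortest_vpath G x z p"
    then have "length p - 1 \<le> length q - 1"
      using q path[OF q] unfolding shortest_vpath_def by (metis vwalk_length_simp)
    then show "?geo p"
      using p le[of p] q unfolding shortest_vpath_def vpath_def vwalk_def
      by (cases p) auto
  next
    assume "?geo p"
    then show "shortest_vpath G x z p"
      using path[of p] le unfolding shortest_vpath_def by auto
  qed
qed

text \<open>Splitting a shortest path at \<open>y\<close> bounds both distances by the lengths of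
  the two pieces, and the triangle inequality gives the reverse bound. Conversely, two geodesics
  joined at \<open>y\<close> have exactly the minimal length, so distinctness of the joined walk
  comes for free.\<close>

lemma on_geodesic_iff:
  assumes "x \<in> verts G" "y \<in> verts G" "w \<in> verts G"
  shows "(\<exists>p. shortest_vpath G x w p \<and> y \<in> set p) \<longleftrightarrow> d x w = d x y + d y w"
proof
  assume "\<exists>p. shortest_vpath G x w p \<and> y \<in> set p"
  then obtain p where p: "vwalk p G" "hd p = x" "last p = w" "length p = Suc (d x w)" "y \<in> set p"
    using shortest_vpath_iff assms by blast
  then obtain p1 p2 where split: "p = p1 @ y # p2"
    by (meson split_list)
  have w1: "vwalk (p1 @ [y]) G" and w2: "vwalk (y # p2) G"
    using p(1) set_vwalk_arcs_append1[of "p1 @ [y]" p2] set_vwalk_arcs_append2[of "y # p2" p1]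
    unfolding split vwalk_def by auto
  have "x \<in> set (p1 @ [y])" using p(2) unfolding split by (cases p1) auto
  then have "d x y \<le> length p1"
    using d_le_walk[OF w1] by fastforce
  moreover have "d y w \<le> length p2"
    using d_le_walk[OF w2, of y] p(3) unfolding split by simp
  ultimately show "d x w = d x y + d y w"
    using p(4) triangle[OF assms] unfolding split by simp
next
  assume d: "d x w = d x y + d y w"
  obtain p q where p: "vwalk p G" "hd p = x" "last p = y" "length p = Suc (d x y)"
    and q: "vwalk q G" "hd q = y" "last q = w" "length q = Suc (d y w)"
    using ex_geodesic_walk assms by metis
  obtain q' where q': "q = y # q'" using q by (cases q) auto
  have ne: "p \<noteq> []" using p by auto
  have "vwalk (p @ q') G"
  proof (cases q')
    case (Cons a r)
    then show ?thesis
      using p q ne unfolding q' vwalk_def by (auto simp: vwalk_arcs_append)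
  qed (use p in simp)
  moreover have "last (p @ q') = w"
    using p q unfolding q' by (cases q') auto
  ultimately have "shortest_vpath G x w (p @ q')"
    using assms p q d ne unfolding q' by (auto simp: shortest_vpath_iff)
  moreover have "y \<in> set (p @ q')"
    using p ne by auto
  ultimately show "\<exists>p. shortest_vpath G x w p \<and> y \<in> set p" by blast
qed

section \<open>Mutually maximally distant pairs and vertex covers\<close>

definition mmd :: "'v \<Rightarrow> 'v \<Rightarrow> bool" where
  "mmd x y \<longleftrightarrow> x \<noteq> y \<and> (\<forall>z. (y, z) \<in> arcs_ends G \<longrightarrow> d x z \<le> d x y)
     \<and> (\<forall>z. (x, z) \<in> arcs_ends G \<longrightarrow> d y z \<le> d y x)"

lemma mmd_sym: "mmd x y \<longleftrightarrow> mmd y x"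
  unfolding mmd_def by auto

text \<open>If \<open>w\<close> lay properly beyond \<open>y\<close>, the first step from
  \<open>y\<close> towards \<open>w\<close> would reach a neighbour of \<open>y\<close> further from
  \<open>x\<close>. Hence only a member of an mmd pair can resolve it.\<close>

lemma mmd_no_extension:
  assumes "mmd x y" "x \<in> verts G" "y \<in> verts G" "w \<in> verts G" "d x w = d x y + d y w"
  shows "w = y"
proof (rule ccontr)
  assume "w \<noteq> y"
  then obtain k where k: "d y w = Suc k"
    using assms d_eq_0 by (metis not0_implies_Suc)
  then obtain z where z: "(y, z) \<in> arcs_ends G" "d z w = k"
    using d_pred assms by blast
  then have "d x w \<le> d x z + k" "d x z \<le> d x y"
    using triangle[of x z w] assms arcs_ends_verts unfolding mmd_def by auto
  then show False using assms k by simp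
qed

text \<open>Among the finitely many pairs \<open>(a, b)\<close> with a geodesic from
  \<open>a\<close> through \<open>x\<close> and then \<open>y\<close> to \<open>b\<close>, take one
  at maximal distance. A neighbour of an end that is further from the other end would give a better
  pair.\<close>

lemma ex_mmd_extension:
  assumes "x \<in> verts G" "y \<in> verts G" "x \<noteq> y"
  shows "\<exists>a\<in>verts G. \<exists>b\<in>verts G. mmd a b \<and> d a b = d a x + d x y + d y b"
proof -
  define E where "E = {(a, b). a \<in> verts G \<and> b \<in> verts G \<and> d a b = d a x + d x y + d y b}"
  have "finite E"
    by (rule finite_subset[of _ "verts G \<times> verts G"]) (auto simp: E_def finite_verts)
  moreover have "(x, y) \<in> E"
    using assms d_eq_0 by (auto simp: E_def)
  ultimately obtain m where m: "m \<in> E" "\<And>m'. m' \<in> E \<Longrightarrow> case_prod d m' \<le> case_prod d m"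
    by (metis (no_types, lifting) Max_ge Max_in empty_iff finite_imageI image_eqI image_iff image_is_empty)
  obtain a b where ab: "m = (a, b)" by (cases m)
  have E: "a \<in> verts G" "b \<in> verts G" "d a b = d a x + d x y + d y b"
    using m(1) by (auto simp: ab E_def)
  have max: "d a' b' \<le> d a b" if "(a', b') \<in> E" for a' b'
    using m(2)[OF that] by (simp add: ab)
  \<comment> \<open>A neighbour \<open>z\<close> of \<open>b\<close> further from \<open>a\<close>
    would have distance exactly one more, since \<open>d y z\<close> exceeds \<open>d y b\<close> by
    at most 1. Then \<open>(a, z)\<close> lies in \<open>E\<close>, against maximality.\<close>
  have "d a z \<le> d a b" if z: "(b, z) \<in> arcs_ends G" for z
  proof (rule ccontr)
    assume "\<not> d a z \<le> d a b"
    moreover have zv: "z \<in> verts G" using z arcs_ends_verts by blast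
    moreover have "d y z \<le> Suc (d y b)"
      using d_step[OF z assms(2)] d_step[of z b y] triangle[of y b z] d_sym E zv assms
        d_step[OF z zv] d_eq_0[OF zv zv] by auto
    moreover have "d a z \<le> d a x + (d x y + d y z)"
      using triangle[of a x z] triangle[of x y z] E zv assms by auto
    ultimately have "(a, z) \<in> E"
      using E by (auto simp: E_def)
    then show False using max \<open>\<not> d a z \<le> d a b\<close> by blast
  qed
  moreover have "d b z \<le> d b a" if z: "(a, z) \<in> arcs_ends G" for z
  proof (rule ccontr)
    assume "\<not> d b z \<le> d b a"
    moreover have zv: "z \<in> verts G" using z arcs_ends_verts by blast
    moreover have "d z x \<le> Suc (d a x)"
      using triangle[of z a x] E zv assms d_step[OF z zv] d_eq_0[OF zv zv] d_sym[of a z] by auto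
    moreover have "d z b \<le> d z x + (d x y + d y b)"
      using triangle[of z x b] triangle[of x y b] E zv assms by auto
    ultimately have "(z, b) \<in> E"
      using E d_sym[of b z] d_sym[of b a] by (auto simp: E_def)
    then show False
      using max \<open>\<not> d b z \<le> d b a\<close> d_sym[of b z] d_sym[of b a] E zv by fastforce
  qed
  moreover have "a \<noteq> b"
    using E assms d_eq_0 by (metis add_is_0)
  ultimately show ?thesis
    using E unfolding mmd_def by blast
qed

text \<open>An mmd pair is resolved only by its own members, so each such pair must meet
  \<open>S\<close>. Conversely, extend any pair to an mmd pair: whichever end belongs to
  \<open>S\<close> resolves the original pair.\<close>

lemma strong_resolving_set_iff:
  "strong_resolving_set G S \<longleftrightarrow>
     S \<subseteq> verts G \<and> (\<forall>x\<in>verts G. \<forall>y\<in>verts G. mmd x y \<longrightarrow> x \<in> S \<or> y \<in> S)"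
proof (cases "S \<subseteq> verts G")
  case S: True
  have res: "strongly_resolves G w x y \<longleftrightarrow> d x w = d x y + d y w \<or> d y w = d y x + d x w"
    if "x \<in> verts G" "y \<in> verts G" "w \<in> S" for w x y
    using that S on_geodesic_iff unfolding strongly_resolves_def by blast
  show ?thesis
  proof
    assume L: "strong_resolving_set G S"
    have "x \<in> S \<or> y \<in> S" if xy: "x \<in> verts G" "y \<in> verts G" "mmd x y" for x y
    proof -
      have "x \<noteq> y" using xy(3) by (simp add: mmd_def)
      then obtain w where "w \<in> S" "strongly_resolves G w x y"
        using L xy unfolding strong_resolving_set_def by blast
      then show ?thesis
        using res xy mmd_no_extension[of x y w] mmd_no_extension[of y x w] mmd_sym S by blast
    qed
    then show "S \<subseteq> verts G \<and> (\<forall>x\<in>verts G. \<forall>y\<in>verts G. mmd x y \<longrightarrow> x \<in> S \<or> y \<in> S)"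
      using S by blast
  next
    assume R: "S \<subseteq> verts G \<and> (\<forall>x\<in>verts G. \<forall>y\<in>verts G. mmd x y \<longrightarrow> x \<in> S \<or> y \<in> S)"
    have "\<exists>w\<in>S. strongly_resolves G w x y" if xy: "x \<in> verts G" "y \<in> verts G" "x \<noteq> y" for x y
    proof -
      obtain a b where ab: "a \<in> verts G" "b \<in> verts G" "mmd a b" "d a b = d a x + d x y + d y b"
        using ex_mmd_extension[OF xy] by blast
      \<comment> \<open>Pieces of a geodesic are geodesics. Cut the one from \<open>a\<close> to
        \<open>b\<close> at \<open>x\<close>, or at \<open>y\<close> and read it backwards.\<close>
      have "d x b = d x y + d y b"
        using triangle[of a x b] triangle[of x y b] ab xy by simp
      moreover have "d y a = d y x + d x a"
        using triangle[of a y b] triangle[of a x y] ab xy d_sym by (simp add: d_sym)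
      ultimately show ?thesis
        using R ab res xy by blast
    qed
    then show "strong_resolving_set G S"
      using S unfolding strong_resolving_set_def by blast
  qed
qed (simp add: strong_resolving_set_def)

text \<open>Complements of vertex covers are the sets without mmd pairs, so a smallest cover
  corresponds to a largest such set \<open>T\<close>. Integers keep the difference free of truncated
  subtraction.\<close>

lemma sdim_eq_card_diff:
  assumes "T \<subseteq> verts G" "\<And>x y. x \<in> T \<Longrightarrow> y \<in> T \<Longrightarrow> \<not> mmd x y" "card T = k"
    and max: "\<And>T. T \<subseteq> verts G \<Longrightarrow> (\<And>x y. x \<in> T \<Longrightarrow> y \<in> T \<Longrightarrow> \<not> mmd x y) \<Longrightarrow> card T \<le> k"
  shows "int (sdim G) = int (card (verts G)) - int k"
proof -
  have "sdim G = card (verts G) - k"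
    unfolding sdim_def
  proof (rule Least_equality)
    have "strong_resolving_set G (verts G - T)"
      using assms unfolding strong_resolving_set_iff by blast
    moreover have "card (verts G - T) = card (verts G) - k"
      using assms finite_verts by (simp add: card_Diff_subset finite_subset)
    ultimately show "\<exists>S. finite S \<and> strong_resolving_set G S \<and> card S = card (verts G) - k"
      using finite_verts by blast
  next
    fix j assume "\<exists>S. finite S \<and> strong_resolving_set G S \<and> card S = j"
    then obtain S where S: "strong_resolving_set G S" "card S = j" by blast
    then have "card (verts G - S) \<le> k"
      unfolding strong_resolving_set_iff by (intro max) auto
    moreover have "card (verts G - S) = card (verts G) - j"
      using S finite_verts unfolding strong_resolving_set_iff
      by (metis card_Diff_subset finite_subset)
    ultimately show "card (verts G) - k \<le> j" by linarith
  qed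
  moreover have "k \<le> card (verts G)"
    using assms(1,3) finite_verts card_mono by blast
  ultimately show ?thesis by simp
qed

end

section \<open>The clean graph\<close>

lemma verts_clean_graph2: "verts (clean_graph2 R) = (idempotents R - {\<zero>\<^bsub>R\<^esub>}) \<times> Units R"
  by (auto simp: clean_graph2_def clean_graph_def)

lemma arcs_ends_clean_graph2:
  "((e, u), (f, v)) \<in> arcs_ends (clean_graph2 R) \<longleftrightarrow>
     (e, u) \<in> verts (clean_graph2 R) \<and> (f, v) \<in> verts (clean_graph2 R) \<and> (e, u) \<noteq> (f, v) \<and>
     (e \<otimes>\<^bsub>R\<^esub> f = \<zero>\<^bsub>R\<^esub> \<or> u \<otimes>\<^bsub>R\<^esub> v = \<one>\<^bsub>R\<^esub>)"
  unfolding verts_clean_graph2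
  by (auto simp: clean_graph2_def clean_graph_def arcs_ends_conv induce_subgraph_def image_iff)

section \<open>Complements of idempotents and inverses of units\<close>

context cring
begin

lemma idempotents_carrier: "e \<in> idempotents R \<Longrightarrow> e \<in> carrier R"
  by (simp add: idempotents_def)

lemma one_zero_idempotents: "\<one> \<in> idempotents R" "\<zero> \<in> idempotents R"
  by (simp_all add: idempotents_def)

lemma mult_compl: "\<lbrakk>a \<in> carrier R; f \<in> carrier R\<rbrakk> \<Longrightarrow> a \<otimes> (\<one> \<ominus> f) = a \<ominus> a \<otimes> f"
  by (simp add: a_minus_def r_distr r_minus)

lemma idempotent_mult_compl:
  assumes "e \<in> idempotents R"
  shows "e \<otimes> (\<one> \<ominus> e) = \<zero>" "(\<one> \<ominus> e) \<otimes> e = \<zero>"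
proof -
  have e: "e \<in> carrier R" "e \<otimes> e = e" using assms by (auto simp: idempotents_def)
  show 1: "e \<otimes> (\<one> \<ominus> e) = \<zero>"
    unfolding mult_compl[OF e(1) e(1)] e(2) using e by (simp add: a_minus_def r_neg)
  then show "(\<one> \<ominus> e) \<otimes> e = \<zero>"
    using e by (metis m_comm minus_closed one_closed)
qed

lemma compl_compl: "e \<in> carrier R \<Longrightarrow> \<one> \<ominus> (\<one> \<ominus> e) = e"
  by (simp add: a_minus_def minus_add r_neg a_assoc[symmetric])

lemma compl_idempotent:
  assumes "e \<in> idempotents R" shows "\<one> \<ominus> e \<in> idempotents R"
proof -
  have e: "e \<in> carrier R" using assms by (auto simp: idempotents_def)
  have "(\<one> \<ominus> e) \<otimes> (\<one> \<ominus> e) = (\<one> \<ominus> e) \<ominus> (\<one> \<ominus> e) \<otimes> e"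
    using e by (simp add: mult_compl)
  then show ?thesis
    using e idempotent_mult_compl[OF assms] by (simp add: idempotents_def a_minus_def)
qed

text \<open>For idempotents the right side is the order of their Boolean algebra: lying below
  \<open>f\<close> means meeting the complement of \<open>f\<close> trivially.\<close>

lemma idempotent_le_iff:
  assumes "a \<in> carrier R" "f \<in> carrier R"
  shows "a \<otimes> (\<one> \<ominus> f) = \<zero> \<longleftrightarrow> a \<otimes> f = a"
  using assms by (simp add: mult_compl) (metis m_closed r_right_minus_eq)

lemma units_inv_unique:
  assumes "u \<in> Units R" "v \<in> Units R" "u \<otimes> v = \<one>" shows "v = inv u"
  using assms Units_closed comm_inv_char by auto

lemma units_mult_eq_one_iff:
  assumes "u \<in> Units R" "v \<in> Units R"
  shows "u \<otimes> v = \<one> \<longleftrightarrow> v = inv u" "u \<otimes> v = \<one> \<longleftrightarrow> u = inv v"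
  using assms units_inv_unique by (metis Units_closed Units_inv_Units Units_r_inv m_comm Units_inv_inv)+

text \<open>Adjacency speaks of inverse units, so the condition on squares is rephrased as not being
  one's own inverse.\<close>

lemma units_sq_not_one_iff:
  "u \<in> units_sq_not_one R \<longleftrightarrow> u \<in> Units R \<and> inv u \<noteq> u"
proof (cases "u \<in> Units R")
  case True
  then have "u [^] (2::nat) = u \<otimes> u"
    by (simp add: numeral_2_eq_2 Units_closed)
  then show ?thesis
    using True units_mult_eq_one_iff[of u u]
    by (auto simp: units_sq_not_one_def units_sq_one_def)
qed (simp add: units_sq_not_one_def)

end

text \<open>The neighbours of \<open>(\<one>, u)\<close> with nonzero first component all have
  second component \<open>inv u\<close>, so distinct vertices \<open>(\<one>, u)\<close> and
  \<open>(\<one>, v)\<close> have no common neighbour. In every other nonadjacent case a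
  complementary idempotent with a suitable inverse unit supplies one.\<close>

definition clean_dist :: "('a, 'm) ring_scheme \<Rightarrow> 'a \<times> 'a \<Rightarrow> 'a \<times> 'a \<Rightarrow> nat" where
  "clean_dist R x y =
     (if x = y then 0
      else if fst x \<otimes>\<^bsub>R\<^esub> fst y = \<zero>\<^bsub>R\<^esub> \<or> snd x \<otimes>\<^bsub>R\<^esub> snd y = \<one>\<^bsub>R\<^esub> then 1
      else if fst x = \<one>\<^bsub>R\<^esub> \<and> fst y = \<one>\<^bsub>R\<^esub> then 3 else 2)"

text \<open>Four idempotents guarantee one besides 0 and 1. A unit that is not its own inverse
  guarantees at least three units.\<close>

locale clean_ring = cring +
  assumes finite_carrier: "finite (carrier R)"
    and card_idempotents: "4 \<le> card (idempotents R)"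
    and sq_not_one: "units_sq_not_one R \<noteq> {}"
begin

abbreviation "Pr \<equiv> idempotents R - {\<zero>, \<one>}"
abbreviation "U \<equiv> Units R"

lemma finite_Id: "finite (idempotents R)"
  by (rule finite_subset[OF _ finite_carrier]) (auto simp: idempotents_def)

lemma finite_U: "finite U"
  by (rule finite_subset[OF _ finite_carrier]) (auto simp: Units_def)

lemma ex_Pr: "\<exists>e. e \<in> Pr"
proof (rule ccontr)
  assume "\<nexists>e. e \<in> Pr"
  then have "idempotents R \<subseteq> {\<zero>, \<one>}" by blast
  then have "card (idempotents R) \<le> card {\<zero>, \<one>}" by (intro card_mono) auto
  also have "\<dots> \<le> 2" by (simp add: card_insert_if)
  finally show False using card_idempotents by simp
qed

lemma compl_Pr: assumes "e \<in> Pr" shows "\<one> \<ominus> e \<in> Pr"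
proof -
  have e: "e \<in> carrier R" using assms by (auto simp: idempotents_def)
  have "\<one> \<ominus> e \<noteq> \<zero>" using e assms by (metis DiffD2 insertCI one_closed r_right_minus_eq)
  moreover have "\<one> \<ominus> e \<noteq> \<one>"
  proof
    assume "\<one> \<ominus> e = \<one>"
    then have "e = \<one> \<ominus> \<one>" using compl_compl[OF e] by simp
    then show False using assms by (simp add: a_minus_def r_neg)
  qed
  ultimately show ?thesis using compl_idempotent assms by blast
qed

lemma one_ne_zero: "\<one> \<noteq> \<zero>"
  using ex_Pr idempotents_carrier by (metis Diff_iff insert_iff r_null r_one)

text \<open>The units \<open>\<one>\<close>, \<open>a\<close> and \<open>inv a\<close> are distinct,
  and two values cannot exhaust three.\<close>

lemma ex_other_unit: "\<exists>w\<in>U. w \<noteq> u \<and> w \<noteq> v"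
proof -
  obtain a where a: "a \<in> U" "inv a \<noteq> a"
    using sq_not_one units_sq_not_one_iff by blast
  then have "a \<noteq> \<one>" "inv a \<noteq> \<one>" "inv a \<in> U"
    by (auto, metis Units_inv_inv inv_one)
  then show ?thesis using a Units_one_closed by metis
qed

lemma idem_mult_self_ne: "e \<in> idempotents R \<Longrightarrow> e \<noteq> \<zero> \<Longrightarrow> e \<otimes> e \<noteq> \<zero>"
  by (simp add: idempotents_def)

lemma clean_dist_sym:
  assumes "x \<in> verts (clean_graph2 R)" "y \<in> verts (clean_graph2 R)"
  shows "clean_dist R x y = clean_dist R y x"
proof -
  have "fst x \<in> carrier R" "fst y \<in> carrier R" "snd x \<in> carrier R" "snd y \<in> carrier R"
    using assms by (auto simp: verts_clean_graph2 idempotents_def Units_closed)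
  then show ?thesis
    unfolding clean_dist_def by (simp add: m_comm)
qed

lemma clean_dist_le: "clean_dist R x y \<le> 3"
  by (simp add: clean_dist_def)

text \<open>Since the formula never exceeds 3, the step condition needs an argument only when the
  distance from \<open>y\<close> to \<open>z\<close> is 0 or 1. The predecessor condition is met by
  explicit neighbours.\<close>

lemma graph_distance: "graph_distance (clean_graph2 R) (clean_dist R)"
proof
  show "finite (verts (clean_graph2 R))"
    by (simp add: verts_clean_graph2 finite_Id finite_U)
next
  fix x y assume "(x, y) \<in> arcs_ends (clean_graph2 R)"
  then show "x \<in> verts (clean_graph2 R) \<and> y \<in> verts (clean_graph2 R)"
    by (cases x; cases y) (auto simp: arcs_ends_clean_graph2)
next
  fix x y assume "x \<in> verts (clean_graph2 R)" "y \<in> verts (clean_graph2 R)"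
  then show "clean_dist R x y = clean_dist R y x" by (rule clean_dist_sym)
  show "clean_dist R x y = 0 \<longleftrightarrow> x = y" by (auto simp: clean_dist_def)
next
  fix x y z
  assume xy: "(x, y) \<in> arcs_ends (clean_graph2 R)" and z: "z \<in> verts (clean_graph2 R)"
  obtain e u f v g w where p: "x = (e, u)" "y = (f, v)" "z = (g, w)"
    by (metis surj_pair)
  have c: "e \<in> idempotents R" "f \<in> idempotents R" "g \<in> idempotents R" "f \<noteq> \<zero>" "u \<in> U" "v \<in> U" "w \<in> U"
    and adj: "e \<otimes> f = \<zero> \<or> u \<otimes> v = \<one>" "x \<noteq> y"
    using xy z unfolding p by (auto simp: arcs_ends_clean_graph2 verts_clean_graph2)
  show "clean_dist R x z \<le> Suc (clean_dist R y z)"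
  proof (cases "clean_dist R y z \<ge> 2")
    case True
    then show ?thesis using clean_dist_le[of x z] by linarith
  next
    case False
    show ?thesis
    proof (cases "y = z")
      case True
      then show ?thesis using adj by (auto simp: clean_dist_def p)
    next
      case ne: False
      then have yz: "f \<otimes> g = \<zero> \<or> v \<otimes> w = \<one>"
        using False by (auto simp: clean_dist_def p split: if_splits)
      \<comment> \<open>Distance 3 would make both outer idempotents 1. Both adjacencies then come
        from the units, which forces \<open>u = w\<close> and hence \<open>x = z\<close>.\<close>
      have "clean_dist R x z \<noteq> 3"
      proof
        assume "clean_dist R x z = 3"
        then have "e = \<one>" "g = \<one>" "x \<noteq> z"
          by (auto simp: clean_dist_def split: if_splits simp: p)
        moreover from this have "u \<otimes> v = \<one>" "v \<otimes> w = \<one>"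
          using adj yz c by (auto simp: idempotents_carrier)
        then have "u = w" using c by (metis units_mult_eq_one_iff)
        ultimately show False by (simp add: p)
      qed
      then have "clean_dist R x z \<le> 2" using clean_dist_le[of x z] by linarith
      moreover have "1 \<le> clean_dist R y z" using ne by (simp add: clean_dist_def)
      ultimately show ?thesis by linarith
    qed
  qed
next
  fix x z k
  assume xz: "x \<in> verts (clean_graph2 R)" "z \<in> verts (clean_graph2 R)" "clean_dist R x z = Suc k"
  obtain e u g w where p: "x = (e, u)" "z = (g, w)"
    by (metis surj_pair)
  have c: "e \<in> idempotents R" "g \<in> idempotents R" "e \<noteq> \<zero>" "g \<noteq> \<zero>" "u \<in> U" "w \<in> U"
    using xz unfolding p by (auto simp: verts_clean_graph2)
  have ne: "x \<noteq> z" using xz(3) by (auto simp: clean_dist_def)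
  note cl = idempotents_carrier[OF c(1)] idempotents_carrier[OF c(2)] Units_closed[OF c(5)]
    Units_closed[OF c(6)]
  show "\<exists>y. (x, y) \<in> arcs_ends (clean_graph2 R) \<and> clean_dist R y z = k"
  proof (cases "e \<otimes> g = \<zero> \<or> u \<otimes> w = \<one>")
    case True
    then have "k = 0" using xz(3) ne by (auto simp: clean_dist_def p)
    then show ?thesis
      using True ne xz by (intro exI[of _ z]) (auto simp: p arcs_ends_clean_graph2 clean_dist_def)
  next
    case nadj: False
    consider "e = \<one>" "g = \<one>" | "g \<noteq> \<one>" | "e \<noteq> \<one>" by blast
    then show ?thesis
    proof cases
      case 1
      then have k: "k = 2" using xz(3) ne nadj by (auto simp: clean_dist_def p)
      \<comment> \<open>The next vertex must carry the unit \<open>inv u\<close>. Any idempotent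
        other than 0 and 1 then brings the distance to \<open>z\<close> down to 2.\<close>
      obtain h where h: "h \<in> Pr" using ex_Pr by blast
      have "u \<noteq> w" using ne 1 by (auto simp: p)
      then have "inv u \<otimes> w \<noteq> \<one>"
        using c by (metis Units_inv_Units Units_inv_inv units_mult_eq_one_iff(1))
      then have "clean_dist R (h, inv u) z = 2"
        using h 1 idempotents_carrier by (auto simp: clean_dist_def p)
      moreover have "(x, (h, inv u)) \<in> arcs_ends (clean_graph2 R)"
        using h c 1 by (auto simp: arcs_ends_clean_graph2 verts_clean_graph2 p)
      ultimately show ?thesis using k by blast
    next
      case 2
      then have k: "k = 1" using xz(3) ne nadj by (auto simp: clean_dist_def p)
      \<comment> \<open>The common neighbour is \<open>(\<one> \<ominus> g, inv u)\<close>: its unit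
        is inverse to that of \<open>x\<close> and its idempotent is orthogonal to that of
        \<open>z\<close>. The remaining case exchanges these roles.\<close>
      have g: "\<one> \<ominus> g \<in> Pr" using compl_Pr 2 c by blast
      have "e \<noteq> \<one> \<ominus> g" using nadj idempotent_mult_compl[OF c(2)] by auto
      moreover have "g \<noteq> \<one> \<ominus> g"
        using idempotent_mult_compl[OF c(2)] idem_mult_self_ne[OF c(2) c(4)] by auto
      ultimately have "(x, (\<one> \<ominus> g, inv u)) \<in> arcs_ends (clean_graph2 R)"
        "clean_dist R (\<one> \<ominus> g, inv u) z = 1"
        using g c idempotent_mult_compl[OF c(2)]
        by (auto simp: arcs_ends_clean_graph2 verts_clean_graph2 p clean_dist_def)
      then show ?thesis using k by blast
    next
      case 3
      then have k: "k = 1" using xz(3) ne nadj by (auto simp: clean_dist_def p)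
      have g: "\<one> \<ominus> e \<in> Pr" using compl_Pr 3 c by blast
      have "g \<noteq> \<one> \<ominus> e" using nadj idempotent_mult_compl[OF c(1)] by auto
      moreover have "e \<noteq> \<one> \<ominus> e"
        using idempotent_mult_compl[OF c(1)] idem_mult_self_ne[OF c(1) c(3)] by auto
      ultimately have "(x, (\<one> \<ominus> e, inv w)) \<in> arcs_ends (clean_graph2 R)"
        "clean_dist R (\<one> \<ominus> e, inv w) z = 1"
        using g c idempotent_mult_compl[OF c(1)]
        by (auto simp: arcs_ends_clean_graph2 verts_clean_graph2 p clean_dist_def)
      then show ?thesis using k by blast
    qed
  qed
qed

sublocale graph_distance "clean_graph2 R" "clean_dist R"
  by (rule graph_distance)

section \<open>Which pairs of vertices are mutually maximally distant\<close>

lemma mmd_one_one: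
  assumes "u \<in> U" "v \<in> U" "v \<noteq> u" "v \<noteq> inv u"
  shows "mmd (\<one>, u) (\<one>, v)"
proof -
  have "u \<otimes> v \<noteq> \<one>" using units_mult_eq_one_iff(1)[OF assms(1,2)] assms by simp
  then have "clean_dist R (\<one>, u) (\<one>, v) = 3" "clean_dist R (\<one>, v) (\<one>, u) = 3"
    using assms one_ne_zero by (auto simp: clean_dist_def m_comm Units_closed)
  then show ?thesis
    using clean_dist_le assms unfolding mmd_def by auto
qed

lemma clean_dist_Pr_le: "fst x \<noteq> \<one> \<or> fst y \<noteq> \<one> \<Longrightarrow> clean_dist R x y \<le> 2"
  by (auto simp: clean_dist_def)

text \<open>The distance is 2, and no vertex is further than 2 from \<open>(e, u)\<close>. From
  \<open>(\<one>, u)\<close> only vertices with idempotent 1 could be further, but the sole such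
  neighbour of \<open>(e, u)\<close> is \<open>(\<one>, inv u)\<close>, which is adjacent to
  \<open>(\<one>, u)\<close>.\<close>

lemma mmd_Pr_one:
  assumes e: "e \<in> Pr" and u: "u \<in> U" "inv u \<noteq> u"
  shows "mmd (e, u) (\<one>, u)"
proof -
  have uu: "u \<otimes> u \<noteq> \<one>" using units_mult_eq_one_iff(1)[OF u(1) u(1)] u by simp
  then have d: "clean_dist R (e, u) (\<one>, u) = 2" "clean_dist R (\<one>, u) (e, u) = 2"
    using e by (auto simp: clean_dist_def idempotents_carrier)
  have "clean_dist R (e, u) z \<le> 2" for z
    using e by (intro clean_dist_Pr_le) auto
  moreover have "clean_dist R (\<one>, u) z \<le> 2" if "((e, u), z) \<in> arcs_ends (clean_graph2 R)" for z
  proof (cases "fst z = \<one>")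
    case True
    then obtain v where z: "z = (\<one>, v)" by (cases z) auto
    then have v: "u \<otimes> v = \<one>"
      using that e by (auto simp: arcs_ends_clean_graph2 idempotents_carrier)
    then show ?thesis by (auto simp: clean_dist_def z)
  qed (auto intro: clean_dist_Pr_le)
  ultimately show ?thesis
    using e d unfolding mmd_def by auto
qed

text \<open>Nonadjacent distinct vertices are at distance 2, which is the largest distance that a
  vertex with idempotent other than 1 can have.\<close>

lemma mmd_Pr_Pr:
  assumes "e \<in> Pr" "f \<in> Pr" "u \<in> U" "v \<in> U" "(e, u) \<noteq> (f, v)" "e \<otimes> f \<noteq> \<zero>" "u \<otimes> v \<noteq> \<one>"
  shows "mmd (e, u) (f, v)"
proof -
  have "clean_dist R (e, u) (f, v) = 2" "clean_dist R (f, v) (e, u) = 2"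
    using assms by (auto simp: clean_dist_def m_comm idempotents_carrier Units_closed)
  moreover have "clean_dist R (e, u) z \<le> 2" "clean_dist R (f, v) z \<le> 2" for z
    using assms by (auto intro!: clean_dist_Pr_le)
  ultimately show ?thesis using assms unfolding mmd_def by auto
qed

text \<open>Distinct such vertices are adjacent, and the neighbour \<open>(e, u)\<close> of the
  second is at distance 2 from the first.\<close>

lemma not_mmd_one_one:
  assumes "u \<in> U"
  shows "\<not> mmd (\<one>, u) (\<one>, inv u)"
proof
  assume m: "mmd (\<one>, u) (\<one>, inv u)"
  then have ne: "inv u \<noteq> u" by (auto simp: mmd_def)
  then have uu: "u \<otimes> u \<noteq> \<one>" using units_mult_eq_one_iff(1)[of u u] assms by simp
  obtain e where e: "e \<in> Pr" using ex_Pr by blast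
  have "((\<one>, inv u), (e, u)) \<in> arcs_ends (clean_graph2 R)"
    using e assms one_ne_zero by (auto simp: arcs_ends_clean_graph2 verts_clean_graph2 one_zero_idempotents)
  moreover have "clean_dist R (\<one>, u) (e, u) = 2" "clean_dist R (\<one>, u) (\<one>, inv u) = 1"
    using e uu ne assms by (auto simp: clean_dist_def idempotents_carrier)
  ultimately show False using m unfolding mmd_def by fastforce
qed

text \<open>If the units are inverse, moving from \<open>(\<one>, v)\<close> to
  \<open>(\<one>, u)\<close> raises the distance from 1 to 2. Otherwise moving from
  \<open>(e, u)\<close> to \<open>(\<one>, inv u)\<close> raises it to 3.\<close>

lemma not_mmd_Pr_one:
  assumes e: "e \<in> Pr" and uv: "u \<in> U" "v \<in> U" "v \<noteq> u"
  shows "\<not> mmd (e, u) (\<one>, v)"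
proof (cases "u \<otimes> v = \<one>")
  case True
  then have "v = inv u" using uv units_inv_unique by blast
  then have uu: "u \<otimes> u \<noteq> \<one>" using units_mult_eq_one_iff(1)[of u u] uv by auto
  have "((\<one>, v), (\<one>, u)) \<in> arcs_ends (clean_graph2 R)"
    using uv True one_ne_zero
    by (auto simp: arcs_ends_clean_graph2 verts_clean_graph2 one_zero_idempotents m_comm Units_closed)
  moreover have "clean_dist R (e, u) (\<one>, u) = 2" "clean_dist R (e, u) (\<one>, v) = 1"
    using e uu uv True by (auto simp: clean_dist_def idempotents_carrier)
  ultimately show ?thesis unfolding mmd_def by fastforce
next
  case False
  have a: "((e, u), (\<one>, inv u)) \<in> arcs_ends (clean_graph2 R)"
    using e uv one_ne_zero
    by (auto simp: arcs_ends_clean_graph2 verts_clean_graph2 one_zero_idempotents)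
  have "v \<noteq> inv u" using False uv by auto
  moreover have "v \<otimes> inv u \<noteq> \<one>"
    using uv by (metis Units_inv_Units Units_inv_inv units_mult_eq_one_iff(2))
  ultimately have "clean_dist R (\<one>, v) (\<one>, inv u) = 3"
    using one_ne_zero uv by (auto simp: clean_dist_def)
  moreover have "clean_dist R (\<one>, v) (e, u) \<le> 2"
    using e by (intro clean_dist_Pr_le) auto
  ultimately show ?thesis using a unfolding mmd_def by fastforce
qed

text \<open>The move from \<open>(e, u)\<close> to \<open>(\<one> \<ominus> e, w)\<close> increases
  the distance to \<open>(f, u)\<close>. Choosing \<open>w\<close> different from
  \<open>inv u\<close> prevents adjacency, and different from \<open>u\<close> prevents equality
  when \<open>f\<close> is the complement of \<open>e\<close>.\<close>

lemma not_mmd_same_unit: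
  assumes e: "e \<in> Pr" "f \<in> Pr" "(\<one> \<ominus> e) \<otimes> f \<noteq> \<zero>" and u: "u \<in> U"
    and d: "clean_dist R (f, u) (e, u) \<le> 1"
  shows "\<not> mmd (f, u) (e, u)"
proof
  assume m: "mmd (f, u) (e, u)"
  obtain w where w: "w \<in> U" "w \<noteq> u" "w \<noteq> inv u" using ex_other_unit by blast
  have c: "e \<in> carrier R" "f \<in> carrier R" "\<one> \<ominus> e \<in> carrier R"
    using e by (auto simp: idempotents_carrier)
  have "((e, u), (\<one> \<ominus> e, w)) \<in> arcs_ends (clean_graph2 R)"
    using e u w compl_Pr[OF e(1)] idempotent_mult_compl(1)[of e]
    by (auto simp: arcs_ends_clean_graph2 verts_clean_graph2)
  moreover have "u \<otimes> w \<noteq> \<one>" using w u units_mult_eq_one_iff(1) by blast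
  then have "clean_dist R (f, u) (\<one> \<ominus> e, w) = 2"
    using e w c m_comm[OF c(2,3)] by (auto simp: clean_dist_def)
  ultimately show False using m d unfolding mmd_def by fastforce
qed

text \<open>For different units, the move from \<open>(e, u)\<close> to
  \<open>(\<one>, inv u)\<close> increases the distance. For equal units and different idempotents,
  one idempotent is not below the other, which allows a move through a complement.\<close>

lemma not_mmd_Pr_Pr:
  assumes e: "e \<in> Pr" "f \<in> Pr" and uv: "u \<in> U" "v \<in> U" and adj: "e \<otimes> f = \<zero> \<or> u \<otimes> v = \<one>"
  shows "\<not> mmd (e, u) (f, v)"
proof (cases "u = v")
  case False
  have c: "e \<in> carrier R" "f \<in> carrier R" using e by (auto simp: idempotents_carrier)
  have "((e, u), (\<one>, inv u)) \<in> arcs_ends (clean_graph2 R)"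
    using e uv one_ne_zero
    by (auto simp: arcs_ends_clean_graph2 verts_clean_graph2 one_zero_idempotents)
  moreover have "v \<otimes> inv u \<noteq> \<one>"
    using uv False by (metis Units_inv_Units Units_inv_inv units_mult_eq_one_iff(2))
  then have "clean_dist R (f, v) (\<one>, inv u) = 2"
    using e c by (auto simp: clean_dist_def)
  moreover have "clean_dist R (f, v) (e, u) \<le> 1"
    using adj m_comm[OF c] m_comm[of u v] uv by (auto simp: clean_dist_def Units_closed)
  ultimately show ?thesis unfolding mmd_def by fastforce
next
  case True
  have c: "e \<in> carrier R" "f \<in> carrier R" using e by (auto simp: idempotents_carrier)
  have d: "clean_dist R (f, v) (e, u) \<le> 1" "clean_dist R (e, u) (f, v) \<le> 1"
    using adj m_comm[OF c] m_comm[of u v] uv by (auto simp: clean_dist_def Units_closed)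
  show ?thesis
  proof (cases "e = f")
    case ne: False
    have "(\<one> \<ominus> e) \<otimes> f \<noteq> \<zero> \<or> (\<one> \<ominus> f) \<otimes> e \<noteq> \<zero>"
    proof (rule ccontr)
      assume "\<not> ?thesis"
      then have "f \<otimes> (\<one> \<ominus> e) = \<zero>" "e \<otimes> (\<one> \<ominus> f) = \<zero>"
        using c by (simp_all add: m_comm)
      then have "f \<otimes> e = f" "e \<otimes> f = e" using c by (simp_all add: idempotent_le_iff)
      then show False using ne m_comm[OF c] by simp
    qed
    then show ?thesis
      using not_mmd_same_unit[of e f u] not_mmd_same_unit[of f e u] e uv d True mmd_sym by auto
  qed (use True in \<open>simp add: mmd_def\<close>)
qed

end

section \<open>Sets without mutually maximally distant pairs\<close>

context clean_ring
begin

text \<open>By \<open>mmd_Pr_Pr\<close> and \<open>not_mmd_Pr_Pr\<close> these are exactly the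
  subsets of \<open>Pr \<times> U\<close> without mmd pairs.\<close>

definition clean_clique :: "('a \<times> 'a) set \<Rightarrow> bool" where
  "clean_clique C \<longleftrightarrow> C \<subseteq> Pr \<times> U \<and>
     (\<forall>e u f v. (e, u) \<in> C \<longrightarrow> (f, v) \<in> C \<longrightarrow> (e, u) \<noteq> (f, v) \<longrightarrow> e \<otimes> f = \<zero> \<or> u \<otimes> v = \<one>)"

text \<open>A nonzero idempotent is not orthogonal to itself, so two vertices over it can be
  adjacent only through inverse units. This limits each fibre to two elements.\<close>

lemma clean_clique_fibre_mult:
  assumes "clean_clique C" "(e, u) \<in> C" "(e, v) \<in> C" "u \<noteq> v"
  shows "v = inv u"
proof -
  have "e \<in> Pr" "u \<in> U" "v \<in> U" using assms by (auto simp: clean_clique_def)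
  moreover have "e \<otimes> e = \<zero> \<or> u \<otimes> v = \<one>"
    using assms unfolding clean_clique_def by blast
  ultimately show ?thesis using idem_mult_self_ne[of e] units_inv_unique by blast
qed

lemma clean_clique_fibre:
  assumes "clean_clique C"
  shows "card (C `` {e}) \<le> 2"
proof (cases "C `` {e} = {}")
  case False
  then obtain u where u: "(e, u) \<in> C" by blast
  then have "C `` {e} \<subseteq> {u, inv u}"
    using clean_clique_fibre_mult[OF assms u] by blast
  then have "card (C `` {e}) \<le> card {u, inv u}" by (intro card_mono) auto
  also have "\<dots> \<le> 2" by (simp add: card_insert_if)
  finally show ?thesis .
qed simp

lemma clean_clique_card:
  assumes "clean_clique C"
  shows "card C = (\<Sum>e\<in>Pr. card (C `` {e}))"
proof -
  have C: "C \<subseteq> Pr \<times> U" using assms by (simp add: clean_clique_def)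
  then have "C = Sigma Pr (\<lambda>e. C `` {e})" by auto
  moreover have "finite (C `` {e})" for e
    by (rule finite_subset[OF _ finite_U]) (use C in auto)
  ultimately show ?thesis
    using finite_Id by (metis card_SigmaI finite_Diff)
qed

text \<open>A vertex over \<open>f\<close> would need a unit inverse to both distinct units over
  \<open>e\<close>.\<close>

lemma clean_clique_double:
  assumes C: "clean_clique C" and e: "card (C `` {e}) = 2"
    and f: "f \<noteq> e" "e \<otimes> f \<noteq> \<zero>"
  shows "C `` {f} = {}"
proof (rule ccontr)
  assume "C `` {f} \<noteq> {}"
  then obtain w where w: "(f, w) \<in> C" by blast
  obtain u v where uv: "(e, u) \<in> C" "(e, v) \<in> C" "u \<noteq> v"
    using e by (auto simp: card_2_iff)
  have "u \<otimes> w = \<one>" "v \<otimes> w = \<one>"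
    using C uv w f unfolding clean_clique_def by blast+
  moreover have "u \<in> U" "v \<in> U" "w \<in> U" using C uv w by (auto simp: clean_clique_def)
  ultimately show False using uv(3) by (metis units_mult_eq_one_iff(2))
qed

lemma card_Pr: "card Pr = card (idempotents R) - 2"
  using finite_Id one_ne_zero one_zero_idempotents by (simp add: card_Diff_subset)

text \<open>The two products add up to \<open>h\<close>.\<close>

lemma mult_or_mult_compl_ne_zero:
  assumes "e \<in> carrier R" "h \<in> carrier R" "h \<noteq> \<zero>"
  shows "e \<otimes> h \<noteq> \<zero> \<or> (\<one> \<ominus> e) \<otimes> h \<noteq> \<zero>"
proof (rule ccontr)
  assume "\<not> ?thesis"
  then have 0: "h \<otimes> (\<one> \<ominus> e) = \<zero>" "h \<otimes> e = \<zero>"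
    using assms by (simp_all add: m_comm)
  then have "h = \<zero>"
    using idempotent_le_iff[of h e] assms by simp
  then show False using assms by simp
qed

text \<open>Idempotents carrying two clique vertices are pairwise orthogonal and empty every other fibre they
  meet; complements (or, if there are at most two such idempotents, some further idempotent and its
  complement) provide at least as many empty fibres.\<close>

lemma clean_clique_bound:
  assumes C: "clean_clique C" and big: "4 < card (idempotents R)"
  shows "card C \<le> card (idempotents R) - 2"
proof -
  define D where "D = {e \<in> Pr. card (C `` {e}) = 2}"
  define Z where "Z = {e \<in> Pr. C `` {e} = {}}"
  have fin: "finite Pr" "finite D" "finite Z"
    using finite_Id by (auto simp: D_def Z_def)
  have DZ: "f \<in> Z" if "e \<in> D" "f \<in> Pr" "f \<noteq> e" "e \<otimes> f \<noteq> \<zero>" for e f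
    using that clean_clique_double[OF C, of e f] by (auto simp: D_def Z_def)
  have disj: "e \<otimes> f = \<zero>" if "e \<in> D" "f \<in> D" "f \<noteq> e" for e f
  proof (rule ccontr)
    assume "e \<otimes> f \<noteq> \<zero>"
    then have "f \<in> Z" using DZ[of e f] that by (auto simp: D_def)
    then show False using that by (auto simp: D_def Z_def)
  qed
  have "card D \<le> card Z"
  proof (cases "\<exists>e\<in>D. D \<subseteq> {e, \<one> \<ominus> e}")
    case True
    then obtain e where e: "e \<in> D" "D \<subseteq> {e, \<one> \<ominus> e}" by blast
    then have eP: "e \<in> Pr" and ec: "e \<in> carrier R" by (auto simp: D_def idempotents_carrier)
    have "\<not> idempotents R \<subseteq> {\<zero>, \<one>, e, \<one> \<ominus> e}"
    proof
      assume "idempotents R \<subseteq> {\<zero>, \<one>, e, \<one> \<ominus> e}"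
      then have "card (idempotents R) \<le> card {\<zero>, \<one>, e, \<one> \<ominus> e}" by (intro card_mono) auto
      also have "\<dots> \<le> 4" by (simp add: card_insert_if)
      finally show False using big by simp
    qed
    then obtain g where g: "g \<in> Pr" "g \<noteq> e" "g \<noteq> \<one> \<ominus> e" by blast
    have gc: "g \<in> carrier R" using g by (auto simp: idempotents_carrier)
    have g': "\<one> \<ominus> g \<in> Pr" "\<one> \<ominus> g \<noteq> e" "\<one> \<ominus> g \<noteq> \<one> \<ominus> e"
      using compl_Pr g compl_compl[OF gc] compl_compl[OF ec] by metis+
    have gg: "g \<noteq> \<one> \<ominus> g"
      using idempotent_mult_compl(1)[of g] idem_mult_self_ne[of g] g by auto
    show ?thesis
    proof (cases "\<one> \<ominus> e \<in> D")
      case True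
      \<comment> \<open>Every further idempotent meets \<open>e\<close> or its complement, and both
        carry two vertices, so its fibre is empty. In particular this holds for \<open>g\<close> and
        its complement.\<close>
      have "h \<in> Z" if "h \<in> Pr" "h \<noteq> e" "h \<noteq> \<one> \<ominus> e" for h
        using mult_or_mult_compl_ne_zero[OF ec, of h] DZ[OF e(1), of h] DZ[OF True, of h] that
        by (auto simp: idempotents_carrier)
      then have "{g, \<one> \<ominus> g} \<subseteq> Z" using g g' by blast
      then have "card {g, \<one> \<ominus> g} \<le> card Z" using fin card_mono by blast
      moreover have "card D \<le> card {e, \<one> \<ominus> e}" using e(2) by (intro card_mono) auto
      moreover have "card {e, \<one> \<ominus> e} \<le> 2" by (simp add: card_insert_if)
      ultimately show ?thesis using gg by simp
    next
      case False
      then have D: "D = {e}" using e by blast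
      have "g \<otimes> e \<noteq> \<zero> \<or> (\<one> \<ominus> g) \<otimes> e \<noteq> \<zero>"
        using mult_or_mult_compl_ne_zero[OF gc ec] eP by blast
      then have "e \<otimes> g \<noteq> \<zero> \<or> e \<otimes> (\<one> \<ominus> g) \<noteq> \<zero>"
        using ec gc by (simp add: m_comm)
      then have "Z \<noteq> {}" using DZ[OF e(1)] g g' by blast
      then show ?thesis using D fin by (simp add: Suc_leI card_gt_0_iff)
    qed
  next
    case False
    \<comment> \<open>A third idempotent \<open>f\<close> in \<open>D\<close> is orthogonal to
      \<open>e\<close>, hence lies below the complement of \<open>e\<close> and empties that
      fibre.\<close>
    have "\<one> \<ominus> e \<in> Z" if e: "e \<in> D" for e
    proof -
      obtain f where f: "f \<in> D" "f \<noteq> e" "f \<noteq> \<one> \<ominus> e" using False e by blast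
      have ef: "e \<in> Pr" "f \<in> Pr" "e \<in> carrier R" "f \<in> carrier R"
        using e f by (auto simp: D_def idempotents_carrier)
      have "f \<otimes> e = \<zero>" using disj f e by blast
      then have "f \<otimes> (\<one> \<ominus> e) \<noteq> \<zero>"
        using idempotent_le_iff[of f e] ef by auto
      then show ?thesis
        using DZ[OF f(1) compl_Pr[OF ef(1)]] f by blast
    qed
    moreover have "inj_on (\<lambda>e. \<one> \<ominus> e) D"
      by (rule inj_on_inverseI[of _ "\<lambda>e. \<one> \<ominus> e"]) (auto simp: D_def compl_compl idempotents_carrier)
    ultimately show ?thesis
      using fin by (intro card_inj_on_le) auto
  qed
  \<comment> \<open>Fibres have size 0, 1 or 2. Counting one vertex per idempotent as the norm,
    members of \<open>D\<close> contribute an excess and members of \<open>Z\<close> a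
    deficit.\<close>
  have "card (C `` {e}) + of_bool (e \<in> Z) \<le> 1 + of_bool (e \<in> D)" if "e \<in> Pr" for e
    using clean_clique_fibre[OF C, of e] that by (auto simp: Z_def D_def)
  then have "(\<Sum>e\<in>Pr. card (C `` {e}) + of_bool (e \<in> Z)) \<le> (\<Sum>e\<in>Pr. 1 + of_bool (e \<in> D))"
    by (intro sum_mono) 
  then have "card C + card Z \<le> card Pr + card D"
    unfolding sum.distrib clean_clique_card[OF C, symmetric]
    using fin by (simp add: of_bool_def sum.If_cases D_def Z_def Int_def cong: conj_cong)
  then show ?thesis using \<open>card D \<le> card Z\<close> card_Pr by linarith
qed

lemma card_verts: "card (verts (clean_graph2 R)) = (card (idempotents R) - 1) * card U"
  using one_zero_idempotents finite_Id by (simp add: verts_clean_graph2 card_cartesian_product)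

text \<open>\<open>A\<close> collects the units occurring with idempotent 1, and \<open>C\<close> is
  the rest. The last clause links the parts by \<open>mmd_Pr_one\<close>: a unit that is not its own
  inverse cannot occur in both.\<close>

lemma independent_split:
  assumes T: "T \<subseteq> verts (clean_graph2 R)" and ind: "\<And>x y. x \<in> T \<Longrightarrow> y \<in> T \<Longrightarrow> \<not> mmd x y"
  shows "\<exists>A C. card T = card A + card C \<and> clean_clique C \<and> A \<subseteq> U \<and>
    (\<forall>u\<in>A. \<forall>v\<in>A. v = u \<or> v = inv u) \<and> (\<forall>e u. (e, u) \<in> C \<longrightarrow> u \<in> A \<longrightarrow> inv u = u)"
proof (intro exI conjI)
  define A where "A = {u. (\<one>, u) \<in> T}"
  define C where "C = T \<inter> Pr \<times> U"
  have T': "T \<subseteq> (idempotents R - {\<zero>}) \<times> U" using T by (simp add: verts_clean_graph2)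
  have fin: "finite T" using T finite_verts finite_subset by blast
  have "T = (\<lambda>u. (\<one>, u)) ` A \<union> C" using T' by (auto simp: A_def C_def)
  moreover have "(\<lambda>u. (\<one>, u)) ` A \<inter> C = {}" by (auto simp: C_def)
  moreover have "card ((\<lambda>u. (\<one>, u)) ` A) = card A" by (intro card_image) (auto simp: inj_on_def)
  ultimately show "card T = card A + card C"
    using fin by (metis card_Un_disjoint finite_Un)
  show "A \<subseteq> U" using T' by (auto simp: A_def)
  show "clean_clique C"
    unfolding clean_clique_def C_def using ind mmd_Pr_Pr by blast
  show "\<forall>u\<in>A. \<forall>v\<in>A. v = u \<or> v = inv u"
    using ind mmd_one_one T' unfolding A_def by blast
  show "\<forall>e u. (e, u) \<in> C \<longrightarrow> u \<in> A \<longrightarrow> inv u = u"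
    using ind mmd_Pr_one unfolding A_def C_def by blast
qed

lemma card_le_2_if_inverse:
  assumes "\<forall>u\<in>A. \<forall>v\<in>A. v = u \<or> v = inv u"
  shows "card A \<le> 2"
proof (cases "A = {}")
  case False
  then obtain u where "u \<in> A" by blast
  then have "A \<subseteq> {u, inv u}" using assms by blast
  then have "card A \<le> card {u, inv u}" by (intro card_mono) auto
  also have "\<dots> \<le> 2" by (simp add: card_insert_if)
  finally show ?thesis .
qed simp

text \<open>This constructs the extremal sets from their two parts. Disjointness of the units
  supplies the hypothesis of \<open>not_mmd_Pr_one\<close> for mixed pairs.\<close>

lemma independent_union:
  assumes A: "A \<subseteq> U" "\<forall>u\<in>A. \<forall>v\<in>A. v = u \<or> v = inv u"
    and C: "clean_clique C" "\<And>e u. (e, u) \<in> C \<Longrightarrow> u \<notin> A"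
  defines "T \<equiv> (\<lambda>u. (\<one>, u)) ` A \<union> C"
  shows "T \<subseteq> verts (clean_graph2 R)" "\<And>x y. x \<in> T \<Longrightarrow> y \<in> T \<Longrightarrow> \<not> mmd x y"
    "card T = card A + card C"
proof -
  have CP: "C \<subseteq> Pr \<times> U" using C by (auto simp: clean_clique_def)
  show "T \<subseteq> verts (clean_graph2 R)"
    using A CP one_ne_zero one_zero_idempotents by (auto simp: T_def verts_clean_graph2)
  have 1: "\<not> mmd (\<one>, u) (\<one>, v)" if "u \<in> A" "v \<in> A" for u v
  proof (cases "v = u")
    case False
    then have "v = inv u" using A(2) that by blast
    then show ?thesis using not_mmd_one_one A(1) that by blast
  qed (simp add: mmd_def)
  have 2: "\<not> mmd (e, u) (\<one>, v)" if "(e, u) \<in> C" "v \<in> A" for e u v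
  proof -
    have "v \<noteq> u" using that C(2) by blast
    moreover have "e \<in> Pr" "u \<in> U" "v \<in> U" using that CP A by auto
    ultimately show ?thesis using not_mmd_Pr_one by blast
  qed
  have 3: "\<not> mmd (e, u) (f, v)" if "(e, u) \<in> C" "(f, v) \<in> C" for e u f v
  proof (cases "(e, u) = (f, v)")
    case False
    then have "e \<otimes> f = \<zero> \<or> u \<otimes> v = \<one>" using C(1) that unfolding clean_clique_def by blast
    moreover have "e \<in> Pr" "f \<in> Pr" "u \<in> U" "v \<in> U" using that CP by auto
    ultimately show ?thesis using not_mmd_Pr_Pr by blast
  qed (simp add: mmd_def)
  show "\<not> mmd x y" if "x \<in> T" "y \<in> T" for x y
    using that 1 2 3 mmd_sym unfolding T_def by (cases x; cases y) blast
  have "(\<lambda>u. (\<one>, u)) ` A \<inter> C = {}" using CP by auto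
  moreover have "card ((\<lambda>u. (\<one>, u)) ` A) = card A" by (intro card_image) (auto simp: inj_on_def)
  moreover have "finite A" "finite C"
    using A(1) CP finite_U finite_Id by (auto intro: finite_subset)
  ultimately show "card T = card A + card C"
    unfolding T_def by (simp add: card_Un_disjoint)
qed

section \<open>The strong metric dimension in terms of idempotents and units\<close>

theorem sdim_clean_graph2_large:
  assumes "4 < card (idempotents R)"
  shows "int (sdim (clean_graph2 R)) =
    (int (card (idempotents R)) - 1) * int (card U) - int (card (idempotents R))"
proof -
  obtain a where a: "a \<in> U" "inv a \<noteq> a"
    using sq_not_one units_sq_not_one_iff by blast
  have a1: "a \<noteq> \<one>" "inv a \<noteq> \<one>"
    using a by (auto, metis Units_inv_inv inv_one)
  \<comment> \<open>The extremal set has one vertex over each idempotent other than 0 and 1, all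
    with the self-inverse unit 1, together with an inverse pair of other units over 1.\<close>
  let ?A = "{a, inv a}" and ?C = "Pr \<times> {\<one>}"
  have cl: "clean_clique ?C" by (auto simp: clean_clique_def)
  have card: "card ?A = 2" "card ?C = card (idempotents R) - 2"
    using a by (auto simp: card_Pr card_cartesian_product)
  note I = independent_union[of ?A ?C, OF _ _ cl]
  have "int (sdim (clean_graph2 R)) = int (card (verts (clean_graph2 R))) - int (card (idempotents R))"
  proof (rule sdim_eq_card_diff)
    show "(\<lambda>u. (\<one>, u)) ` ?A \<union> ?C \<subseteq> verts (clean_graph2 R)"
      using a a1 by (intro I) auto
    show "\<not> mmd x y" if "x \<in> (\<lambda>u. (\<one>, u)) ` ?A \<union> ?C" "y \<in> (\<lambda>u. (\<one>, u)) ` ?A \<union> ?C" for x y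
      using a a1 that by (intro I(2)) auto
    have "card ((\<lambda>u. (\<one>, u)) ` ?A \<union> ?C) = card ?A + card ?C"
      using a a1 by (intro I(3)) auto
    then show "card ((\<lambda>u. (\<one>, u)) ` ?A \<union> ?C) = card (idempotents R)"
      unfolding card using assms by simp
    show "card T \<le> card (idempotents R)"
      if T: "T \<subseteq> verts (clean_graph2 R)" "\<And>x y. x \<in> T \<Longrightarrow> y \<in> T \<Longrightarrow> \<not> mmd x y" for T
    proof -
      obtain A C where "card T = card A + card C" "clean_clique C"
        "\<forall>u\<in>A. \<forall>v\<in>A. v = u \<or> v = inv u"
        using independent_split[OF T] by auto
      then show ?thesis
        using card_le_2_if_inverse[of A] clean_clique_bound[of C] assms by fastforce
    qed
  qed
  then show ?thesis
    unfolding card_verts using assms by (simp add: of_nat_diff)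
qed

text \<open>With four idempotents, \<open>Pr\<close> consists of one complementary pair. Vertices
  over different idempotents are adjacent by orthogonality, and those over the same one by inverse
  units.\<close>

lemma double_clique:
  assumes "card (idempotents R) = 4" "a \<in> U" "inv a \<noteq> a"
  shows "clean_clique (Pr \<times> {a, inv a})" "card (Pr \<times> {a, inv a}) = 4"
proof -
  have ct: "card Pr = 2" using assms by (simp add: card_Pr)
  show "card (Pr \<times> {a, inv a}) = 4"
    using assms by (simp add: card_cartesian_product ct)
  have "e \<otimes> f = \<zero>" if ef: "e \<in> Pr" "f \<in> Pr" "e \<noteq> f" for e f
  proof -
    have "e \<noteq> \<one> \<ominus> e"
      using idempotent_mult_compl(1)[of e] idem_mult_self_ne[of e] ef by auto
    then have "card {e, \<one> \<ominus> e} = card Pr" using ct by simp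
    then have "{e, \<one> \<ominus> e} = Pr"
      using ef compl_Pr finite_Id by (intro card_subset_eq) auto
    then have "f \<in> {e, \<one> \<ominus> e}" using ef(2) by simp
    then have "f = \<one> \<ominus> e" using ef(3) by simp
    then show ?thesis using idempotent_mult_compl(1)[of e] ef(1) by simp
  qed
  then show "clean_clique (Pr \<times> {a, inv a})"
    using assms unfolding clean_clique_def by (auto simp: Units_closed)
qed

lemma clean_clique_small:
  assumes "card (idempotents R) = 4" "clean_clique C"
  shows "card C \<le> 4"
proof -
  have "card C \<le> (\<Sum>e\<in>Pr. 2)"
    unfolding clean_clique_card[OF assms(2)]
    by (intro sum_mono clean_clique_fibre assms)
  also have "\<dots> = 4" using assms by (simp add: card_Pr)
  finally show ?thesis .
qed

theorem sdim_clean_graph2_four_large: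
  assumes c4: "card (idempotents R) = 4" and "card (units_sq_not_one R) \<noteq> 2"
  shows "int (sdim (clean_graph2 R)) = 3 * int (card U) - 6"
proof -
  obtain a where a: "a \<in> U" "inv a \<noteq> a"
    using sq_not_one units_sq_not_one_iff by blast
  have "{a, inv a} \<subseteq> units_sq_not_one R"
    using a by (auto simp: units_sq_not_one_iff)
  moreover have "card {a, inv a} = 2" using a by simp
  \<comment> \<open>A second inverse pair, disjoint from \<open>{a, inv a}\<close>, can be placed
    over 1 while the first fills the clique, giving 2 + 4 vertices.\<close>
  ultimately have "\<exists>b \<in> units_sq_not_one R. b \<notin> {a, inv a}"
    using assms by (metis subsetI subset_antisym)
  then obtain b where b: "b \<in> U" "inv b \<noteq> b" "b \<noteq> a" "b \<noteq> inv a"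
    by (auto simp: units_sq_not_one_iff)
  have ib: "inv b \<noteq> a" "inv b \<noteq> inv a"
    using b a by (metis Units_inv_inv)+
  let ?A = "{b, inv b}" and ?C = "Pr \<times> {a, inv a}"
  note cl = double_clique[OF c4 a]
  note I = independent_union[of ?A ?C, OF _ _ cl(1)]
  have "int (sdim (clean_graph2 R)) = int (card (verts (clean_graph2 R))) - int 6"
  proof (rule sdim_eq_card_diff)
    show "(\<lambda>u. (\<one>, u)) ` ?A \<union> ?C \<subseteq> verts (clean_graph2 R)"
      using a b ib by (intro I) auto
    show "\<not> mmd x y" if "x \<in> (\<lambda>u. (\<one>, u)) ` ?A \<union> ?C" "y \<in> (\<lambda>u. (\<one>, u)) ` ?A \<union> ?C" for x y
      using a b ib that by (intro I(2)) auto
    have "card ((\<lambda>u. (\<one>, u)) ` ?A \<union> ?C) = card ?A + card ?C"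
      using a b ib by (intro I(3)) auto
    then show "card ((\<lambda>u. (\<one>, u)) ` ?A \<union> ?C) = 6"
      unfolding cl using b by simp
    show "card T \<le> 6"
      if T: "T \<subseteq> verts (clean_graph2 R)" "\<And>x y. x \<in> T \<Longrightarrow> y \<in> T \<Longrightarrow> \<not> mmd x y" for T
    proof -
      obtain A C where "card T = card A + card C" "clean_clique C"
        "\<forall>u\<in>A. \<forall>v\<in>A. v = u \<or> v = inv u"
        using independent_split[OF T] by auto
      then show ?thesis
        using card_le_2_if_inverse[of A] clean_clique_small[OF c4, of C] by fastforce
    qed
  qed
  then show ?thesis
    unfolding card_verts using assms by simp
qed

text \<open>There is only one inverse pair of distinct units. If it is placed over 1, the clique is
  left with self-inverse units and has at most two vertices. Otherwise at most one vertex over 1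
  joins a clique of size at most four.\<close>

theorem sdim_clean_graph2_four_small:
  assumes c4: "card (idempotents R) = 4" and two: "card (units_sq_not_one R) = 2"
  shows "int (sdim (clean_graph2 R)) = 3 * int (card U) - 5"
proof -
  obtain a where a: "a \<in> U" "inv a \<noteq> a"
    using sq_not_one units_sq_not_one_iff by blast
  have a1: "a \<noteq> \<one>" "inv a \<noteq> \<one>"
    using a by (auto, metis Units_inv_inv inv_one)
  have sub: "{a, inv a} \<subseteq> units_sq_not_one R"
    using a by (auto simp: units_sq_not_one_iff)
  have "finite (units_sq_not_one R)" using two card.infinite by fastforce
  then have N: "units_sq_not_one R = {a, inv a}"
    using sub a two by (metis card_2_iff card_subset_eq)
  let ?A = "{\<one>}" and ?C = "Pr \<times> {a, inv a}"
  note cl = double_clique[OF c4 a]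
  note I = independent_union[of ?A ?C, OF _ _ cl(1)]
  have "int (sdim (clean_graph2 R)) = int (card (verts (clean_graph2 R))) - int 5"
  proof (rule sdim_eq_card_diff)
    show "(\<lambda>u. (\<one>, u)) ` ?A \<union> ?C \<subseteq> verts (clean_graph2 R)"
      using a a1 by (intro I) auto
    show "\<not> mmd x y" if "x \<in> (\<lambda>u. (\<one>, u)) ` ?A \<union> ?C" "y \<in> (\<lambda>u. (\<one>, u)) ` ?A \<union> ?C" for x y
      using a a1 that by (intro I(2)) auto
    have "card ((\<lambda>u. (\<one>, u)) ` ?A \<union> ?C) = card ?A + card ?C"
      using a a1 by (intro I(3)) auto
    then show "card ((\<lambda>u. (\<one>, u)) ` ?A \<union> ?C) = 5"
      unfolding cl by simp
    show "card T \<le> 5"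
      if T: "T \<subseteq> verts (clean_graph2 R)" "\<And>x y. x \<in> T \<Longrightarrow> y \<in> T \<Longrightarrow> \<not> mmd x y" for T
    proof -
      obtain A C where AC: "card T = card A + card C" "clean_clique C" "A \<subseteq> U"
        "\<forall>u\<in>A. \<forall>v\<in>A. v = u \<or> v = inv u"
        "\<forall>e u. (e, u) \<in> C \<longrightarrow> u \<in> A \<longrightarrow> inv u = u"
        using independent_split[OF T] by auto
      show ?thesis
      proof (cases "card A = 2")
        case True
        then obtain u v where uv: "A = {u, v}" "u \<noteq> v" by (meson card_2_iff)
        then have "u \<in> A" "v \<in> A" by simp_all
        then have v: "v = inv u" using AC(4) uv(2) by metis
        have "{u, v} \<subseteq> units_sq_not_one R"
          using uv(2) \<open>u \<in> A\<close> AC(3) unfolding v by (auto simp: units_sq_not_one_iff)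
        then have AN: "A = units_sq_not_one R"
          using uv unfolding N by auto
        have inv: "inv w = w" if "(e, w) \<in> C" for e w
        proof (rule ccontr)
          assume "inv w \<noteq> w"
          moreover have "w \<in> U" using that AC(2) by (auto simp: clean_clique_def)
          ultimately have "w \<in> A" by (simp add: AN units_sq_not_one_iff)
          then show False using AC(5) that \<open>inv w \<noteq> w\<close> by blast
        qed
        have "card (C `` {e}) \<le> 1" for e
        proof -
          have "w = w'" if "(e, w) \<in> C" "(e, w') \<in> C" for w w'
            using clean_clique_fibre_mult[OF AC(2) that] inv that by metis
          then obtain w where "C `` {e} \<subseteq> {w}" by blast
          then show ?thesis using card_mono[of "{w}" "C `` {e}"] by simp
        qed
        then have "card C \<le> (\<Sum>e\<in>Pr. 1)"
          unfolding clean_clique_card[OF AC(2)] by (intro sum_mono)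
        then have "card C \<le> 2" using c4 by (simp add: card_Pr)
        then show ?thesis using AC True by simp
      next
        case False
        then show ?thesis
          using AC(1) card_le_2_if_inverse[of A, OF AC(4)] clean_clique_small[OF c4 AC(2)] by fastforce
      qed
    qed
  qed
  then show ?thesis
    unfolding card_verts using assms by simp
qed

end

section \<open>Products of local rings\<close>

text \<open>Writing the square as a product lets the set be carried directly through isomorphisms
  and direct products.\<close>

abbreviation nontrivial_sq :: "('a, 'm) ring_scheme \<Rightarrow> 'a set" where
  "nontrivial_sq R \<equiv> {u \<in> Units R. u \<otimes>\<^bsub>R\<^esub> u \<noteq> \<one>\<^bsub>R\<^esub>}"

lemma units_sq_not_one_eq:
  assumes "monoid R"
  shows "units_sq_not_one R = nontrivial_sq R"
proof -
  have "u [^]\<^bsub>R\<^esub> (2::nat) = u \<otimes>\<^bsub>R\<^esub> u" if "u \<in> Units R" for u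
    using assms that by (simp add: numeral_2_eq_2 monoid.nat_pow_Suc monoid.nat_pow_0 monoid.Units_closed monoid.l_one)
  then show ?thesis by (auto simp: units_sq_not_one_def units_sq_one_def)
qed

lemma ring_iso_image:
  assumes "ring R" and f: "f \<in> ring_iso R S"
  shows ring_iso_image_idempotents: "f ` idempotents R = idempotents S"
    and ring_iso_image_nontrivial_sq: "f ` nontrivial_sq R = nontrivial_sq S"
proof -
  interpret ring R by fact
  note f = ring_iso_memE[OF f]
  have inj: "f x = f y \<longleftrightarrow> x = y" if "x \<in> carrier R" "y \<in> carrier R" for x y
    using that f(5) by (auto simp: bij_betw_def inj_on_def)
  have surj: "\<exists>x\<in>carrier R. y = f x" if "y \<in> carrier S" for y
    using that f(5) by (auto simp: bij_betw_def)
  show "f ` idempotents R = idempotents S"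
  proof (intro equalityI subsetI)
    fix y assume "y \<in> idempotents S"
    then obtain x where "x \<in> carrier R" "y = f x" "f x \<otimes>\<^bsub>S\<^esub> f x = f x"
      using surj by (auto simp: idempotents_def)
    then show "y \<in> f ` idempotents R"
      using inj[of "x \<otimes>\<^bsub>R\<^esub> x" x] f(2) by (auto simp: idempotents_def)
  qed (auto simp: idempotents_def f(1) simp flip: f(2))
  have U: "f x \<in> Units S \<longleftrightarrow> x \<in> Units R" if x: "x \<in> carrier R" for x
  proof
    assume "f x \<in> Units S"
    then obtain y where y: "y \<in> carrier R" "f y \<otimes>\<^bsub>S\<^esub> f x = \<one>\<^bsub>S\<^esub>" "f x \<otimes>\<^bsub>S\<^esub> f y = \<one>\<^bsub>S\<^esub>"
      using surj unfolding Units_def by blast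
    then have "f (y \<otimes>\<^bsub>R\<^esub> x) = f \<one>\<^bsub>R\<^esub>" "f (x \<otimes>\<^bsub>R\<^esub> y) = f \<one>\<^bsub>R\<^esub>"
      using x f by simp_all
    then show "x \<in> Units R"
      using x y(1) inj by (auto simp: Units_def)
  next
    assume "x \<in> Units R"
    then show "f x \<in> Units S"
      using f by (auto simp: Units_def) (metis f(2,4))
  qed
  have UC: "Units S \<subseteq> carrier S" "Units R \<subseteq> carrier R" by (auto simp: Units_def)
  have "f ` Units R = Units S"
    using U surj UC by (auto simp: subset_iff) (metis image_iff)
  have "f x \<otimes>\<^bsub>S\<^esub> f x \<noteq> \<one>\<^bsub>S\<^esub> \<longleftrightarrow> x \<otimes>\<^bsub>R\<^esub> x \<noteq> \<one>\<^bsub>R\<^esub>" if "x \<in> carrier R" for x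
    using inj[of "x \<otimes>\<^bsub>R\<^esub> x" "\<one>\<^bsub>R\<^esub>"] that f by auto
  then show "f ` nontrivial_sq R = nontrivial_sq S"
    unfolding \<open>f ` Units R = Units S\<close>[symmetric] using UC(2) by auto
qed

lemma ring_iso_card:
  assumes "ring R" "R \<simeq> S"
  shows ring_iso_card_idempotents: "card (idempotents R) = card (idempotents S)"
    and ring_iso_card_nontrivial_sq: "card (nontrivial_sq R) =
      card (nontrivial_sq S)"
    and ring_iso_finite: "finite (carrier R) \<longleftrightarrow> finite (carrier S)"
proof -
  obtain f where f: "f \<in> ring_iso R S" using assms by (auto simp: is_ring_iso_def)
  have bij: "bij_betw f (carrier R) (carrier S)" by (rule ring_iso_memE(5)[OF f])
  then have inj: "inj_on f A" if "A \<subseteq> carrier R" for A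
    using that inj_on_subset bij_betw_def by metis
  show "card (idempotents R) = card (idempotents S)"
    unfolding ring_iso_image_idempotents[OF assms(1) f, symmetric]
    by (intro card_image[symmetric] inj) (auto simp: idempotents_def)
  show "card (nontrivial_sq R) = card (nontrivial_sq S)"
    unfolding ring_iso_image_nontrivial_sq[OF assms(1) f, symmetric]
    by (intro card_image[symmetric] inj) (auto simp: Units_def)
  show "finite (carrier R) \<longleftrightarrow> finite (carrier S)"
    using bij bij_betw_finite by blast
qed

lemma RDirProd_simps:
  "(a, b) \<otimes>\<^bsub>RDirProd R S\<^esub> (c, d) = (a \<otimes>\<^bsub>R\<^esub> c, b \<otimes>\<^bsub>S\<^esub> d)"
  "\<one>\<^bsub>RDirProd R S\<^esub> = (\<one>\<^bsub>R\<^esub>, \<one>\<^bsub>S\<^esub>)"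
  by (simp_all add: RDirProd_def DirProd_def monoid.defs)

lemma idempotents_RDirProd: "idempotents (RDirProd R S) = idempotents R \<times> idempotents S"
  by (auto simp: idempotents_def RDirProd_carrier RDirProd_simps)

lemma Units_RDirProd: "Units (RDirProd R S) = Units R \<times> Units S"
  by (auto simp: Units_def RDirProd_carrier RDirProd_simps) blast

text \<open>The principal ideal of a nonunit is proper, and a finite ring has only finitely many
  ideals, so a maximal proper ideal above it exists.\<close>

lemma (in cring) ex_maximalideal:
  assumes fin: "finite (carrier R)" and a: "a \<in> carrier R" "a \<notin> Units R"
  shows "\<exists>M. maximalideal M R \<and> a \<in> M"
proof -
  define F where "F = {I. ideal I R \<and> a \<in> I \<and> \<one> \<notin> I}"
  have sub: "I \<subseteq> carrier R" if "ideal I R" for I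
    using that by (simp add: additive_subgroup.a_subset ideal.axioms(1))
  have "F \<subseteq> Pow (carrier R)" using sub by (auto simp: F_def)
  then have "finite F" using fin finite_subset by blast
  moreover have "PIdl a \<in> F"
    using a cgenideal_ideal cgenideal_self by (auto simp: F_def cgenideal_def Units_def m_comm)
  ultimately obtain I where I: "I \<in> F" "\<forall>J\<in>F. I \<subseteq> J \<longrightarrow> I = J"
    using finite_has_maximal[of F] by blast
  have "maximalideal I R"
  proof (intro maximalidealI)
    show "ideal I R" "carrier R \<noteq> I" using I(1) by (auto simp: F_def)
    fix J assume J: "ideal J R" "I \<subseteq> J" "J \<subseteq> carrier R"
    show "J = I \<or> J = carrier R"
    proof (cases "\<one> \<in> J")
      case True
      then show ?thesis using J ideal.one_imp_carrier by blast
    next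
      case False
      then have "J \<in> F" using J I(1) by (auto simp: F_def)
      then show ?thesis using J I(2) by blast
    qed
  qed
  then show ?thesis using I(1) by (auto simp: F_def)
qed

section \<open>Finite local rings and their idempotents\<close>

locale finite_local_ring = cring +
  assumes finite_carrier: "finite (carrier R)" and local: "local_ring R"
begin

definition nonunits where "nonunits = carrier R - Units R"

text \<open>The unique maximal ideal contains no unit, being proper, and contains every nonunit,
  since each nonunit lies in some maximal ideal.\<close>

lemma maximalideal_nonunits: "maximalideal nonunits R"
proof -
  obtain M where M: "maximalideal M R" and uniq: "\<And>N. maximalideal N R \<Longrightarrow> N = M"
    using local by (auto simp: local_ring_def)
  interpret M: maximalideal M R by fact
  have "u \<notin> M" if u: "u \<in> Units R" for u
  proof
    assume "u \<in> M"
    then have "inv u \<otimes> u \<in> M" using u by (intro M.I_l_closed) auto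
    then show False using u M.one_imp_carrier M.I_notcarr by auto
  qed
  moreover have "a \<in> M" if "a \<in> carrier R" "a \<notin> Units R" for a
    using ex_maximalideal[OF finite_carrier that] uniq by blast
  ultimately have "nonunits = M"
    using M.a_subset by (auto simp: nonunits_def)
  then show ?thesis using M by simp
qed

sublocale N: maximalideal nonunits R
  by (rule maximalideal_nonunits)

lemma zero_not_unit: "\<zero> \<notin> Units R"
  using N.zero_closed by (auto simp: nonunits_def)

lemma one_ne_zero: "\<one> \<noteq> \<zero>"
  using zero_not_unit Units_one_closed by metis

text \<open>Otherwise 1 would be a difference of two nonunits, hence a nonunit.\<close>

lemma one_add_nonunit: assumes "m \<in> nonunits" shows "\<one> \<oplus> m \<in> Units R"
proof (rule ccontr)
  assume "\<one> \<oplus> m \<notin> Units R"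
  moreover have m: "m \<in> carrier R" using assms by (simp add: nonunits_def)
  ultimately have "\<one> \<oplus> m \<in> nonunits" by (simp add: nonunits_def)
  then have "(\<one> \<oplus> m) \<ominus> m \<in> nonunits"
    using assms by (simp add: a_minus_def)
  moreover have "(\<one> \<oplus> m) \<ominus> m = \<one>" using m by (simp add: a_minus_def a_assoc r_neg)
  ultimately show False by (simp add: nonunits_def)
qed

text \<open>Either \<open>e\<close> or its complement is a unit. Since their product is zero, the
  other one vanishes.\<close>

lemma idempotents_eq: "idempotents R = {\<zero>, \<one>}"
proof
  show "idempotents R \<subseteq> {\<zero>, \<one>}"
  proof
    fix e assume e: "e \<in> idempotents R"
    then have ec: "e \<in> carrier R" "e \<otimes> e = e" by (auto simp: idempotents_def)
    have z: "x = \<zero>" if "u \<in> Units R" "x \<in> carrier R" "u \<otimes> x = \<zero>" for u x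
      using that by (metis Units_closed Units_l_cancel r_null zero_closed)
    show "e \<in> {\<zero>, \<one>}"
    proof (cases "e \<in> Units R")
      case True
      then have "\<one> \<ominus> e = \<zero>"
        using z[of e "\<one> \<ominus> e"] idempotent_mult_compl[OF e] ec by simp
      then show ?thesis using ec by simp
    next
      case False
      then have "e \<in> nonunits" using ec by (simp add: nonunits_def)
      then have "\<one> \<oplus> (\<ominus> e) \<in> Units R"
        by (intro one_add_nonunit N.a_inv_closed)
      then have "e = \<zero>"
        using z[of "\<one> \<ominus> e" e] idempotent_mult_compl[OF e] ec by (simp add: a_minus_def)
      then show ?thesis by simp
    qed
  qed
qed (use one_zero_idempotents in auto)

end

text \<open>Each local factor contributes the idempotents 0 and 1. Finiteness of the factors is
  proved in the same induction because the description of local idempotents requires it.\<close>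

lemma card_idempotents_RDirProd_list:
  assumes "\<forall>S\<in>set Rs. local_ring S" "finite (carrier (RDirProd_list Rs))"
  shows "card (idempotents (RDirProd_list Rs)) = 2 ^ length Rs \<and> (\<forall>S\<in>set Rs. finite (carrier S))"
  using assms
proof (induction Rs)
  case Nil
  have "idempotents (nil_ring :: 'a list ring) = {[]}"
    by (auto simp: idempotents_def monoid.defs)
  then show ?case by simp
next
  case (Cons S Rs)
  have ringS: "cring S" and rings: "\<And>T. T \<in> set Rs \<Longrightarrow> ring T"
    using Cons.prems(1) by (auto simp: local_ring_def cring_def)
  have ring: "ring (RDirProd_list Rs)"
    using rings by (intro RDirProd_list_is_ring) auto
  have iso: "RDirProd S (RDirProd_list Rs) \<simeq> RDirProd_list (S # Rs)"
    using RDirProd_list_iso1 by (auto simp: is_ring_iso_def)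
  have ringP: "ring (RDirProd S (RDirProd_list Rs))"
    using ringS ring RDirProd_ring cring_def by blast
  have "finite (carrier S \<times> carrier (RDirProd_list Rs))"
    using ring_iso_finite[OF ringP iso] Cons.prems(2) by (simp add: RDirProd_carrier)
  \<comment> \<open>Nonempty factors are needed to pass from a finite product to finite
    factors.\<close>
  moreover have "carrier S \<noteq> {}" "carrier (RDirProd_list Rs) \<noteq> {}"
    using ringS ring by (auto dest: cring.cring_simprules(6) ring.ring_simprules(6))
  ultimately have fin: "finite (carrier S)" "finite (carrier (RDirProd_list Rs))"
    using finite_cartesian_productD1 finite_cartesian_productD2 by blast+
  interpret S: finite_local_ring S
    using ringS fin Cons.prems(1) by (simp add: finite_local_ring_def finite_local_ring_axioms_def)
  show ?case
    using Cons fin S.one_ne_zero ring_iso_card_idempotents[OF ringP iso]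
    by (simp add: idempotents_RDirProd card_cartesian_product S.idempotents_eq)
qed

section \<open>Small model rings\<close>

text \<open>The triple \<open>(a, b, c)\<close> stands for \<open>a + b x + c x\<^sup>2\<close>, where \<open>x\<^sup>3 = 0\<close>, \<open>2 x = 0\<close>, and
  \<open>2 = x\<^sup>2\<close> or \<open>2 = 0\<close> according to \<open>\<kappa>\<close>.\<close>

definition cubic_ring :: "bool \<Rightarrow> (bool \<times> bool \<times> bool) ring" where
  "cubic_ring \<kappa> = \<lparr> carrier = UNIV,
      monoid.mult = (\<lambda>(a, b, c) (d, e, f).
        (a \<and> d, (a \<and> e) \<noteq> (b \<and> d), ((a \<and> f) \<noteq> (b \<and> e)) \<noteq> (c \<and> d))),
      monoid.one = (True, False, False),
      ring.zero = (False, False, False),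
      ring.add = (\<lambda>(a, b, c) (d, e, f). (a \<noteq> d, b \<noteq> e, (c \<noteq> f) \<noteq> (\<kappa> \<and> a \<and> d))) \<rparr>"

lemma cring_cubic_ring: "cring (cubic_ring \<kappa>)"
proof (intro cringI)
  \<comment> \<open>The negative flips the last bit exactly when adding the constant 1 to itself
    carries into \<open>x\<^sup>2\<close>.\<close>
  have "(a, b, c \<noteq> (\<kappa> \<and> a)) \<oplus>\<^bsub>cubic_ring \<kappa>\<^esub> (a, b, c) = \<zero>\<^bsub>cubic_ring \<kappa>\<^esub>" for a b c
    by (auto simp: cubic_ring_def)
  then have "\<exists>y \<in> carrier (cubic_ring \<kappa>). y \<oplus>\<^bsub>cubic_ring \<kappa>\<^esub> x = \<zero>\<^bsub>cubic_ring \<kappa>\<^esub>" for x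
    by (cases x) (auto simp: cubic_ring_def)
  then show "abelian_group (cubic_ring \<kappa>)"
    by (intro abelian_groupI) (simp_all add: cubic_ring_def split_paired_all, argo+)
  show "comm_monoid (cubic_ring \<kappa>)"
    by (rule comm_monoidI) (simp_all add: cubic_ring_def split_paired_all, argo+)
  show "(x \<oplus>\<^bsub>cubic_ring \<kappa>\<^esub> y) \<otimes>\<^bsub>cubic_ring \<kappa>\<^esub> z =
      x \<otimes>\<^bsub>cubic_ring \<kappa>\<^esub> z \<oplus>\<^bsub>cubic_ring \<kappa>\<^esub> y \<otimes>\<^bsub>cubic_ring \<kappa>\<^esub> z" for x y z
    by (cases x; cases y; cases z) (simp add: cubic_ring_def, argo)
qed

lemma Units_cubic_ring: "Units (cubic_ring \<kappa>) = {x. fst x}"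
proof -
  have "(a, b, c) \<in> Units (cubic_ring \<kappa>) \<longleftrightarrow> a" for a b c
  proof
    assume a
    \<comment> \<open>The inverse of \<open>1 + b x + c x\<^sup>2\<close> is
      \<open>1 + b x + (b + c) x\<^sup>2\<close>, with the sum of bits taken modulo 2.\<close>
    then have "(a, b, c) \<otimes>\<^bsub>cubic_ring \<kappa>\<^esub> (True, b, c \<noteq> b) = \<one>\<^bsub>cubic_ring \<kappa>\<^esub>"
      "(True, b, c \<noteq> b) \<otimes>\<^bsub>cubic_ring \<kappa>\<^esub> (a, b, c) = \<one>\<^bsub>cubic_ring \<kappa>\<^esub>"
      by (auto simp: cubic_ring_def)
    then show "(a, b, c) \<in> Units (cubic_ring \<kappa>)"
      unfolding Units_def by (auto simp: cubic_ring_def)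
  qed (auto simp: Units_def cubic_ring_def)
  then show ?thesis by auto
qed

text \<open>The square of \<open>1 + b x + c x\<^sup>2\<close> is \<open>1 + b x\<^sup>2\<close>, so
  \<open>b\<close> decides and \<open>c\<close> is free.\<close>

lemma card_nontrivial_sq_cubic_ring:
  "card (nontrivial_sq (cubic_ring \<kappa>)) = 2"
proof -
  have "nontrivial_sq (cubic_ring \<kappa>) =
    {(True, True, False), (True, True, True)}"
    unfolding Units_cubic_ring by (auto simp: cubic_ring_def)
  then show ?thesis by simp
qed

lemma card_nontrivial_sq_F4: "card (nontrivial_sq F4) = 2"
proof -
  have "Units F4 = UNIV - {(False, False)}"
    using field.field_Units[OF field_F4] by (simp add: F4_def)
  then have "nontrivial_sq F4 = {(False, True), (True, True)}"
    by (auto simp: F4_def)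
  then show ?thesis by simp
qed

section \<open>Residue rings of prime order\<close>

lemma cring_residue_ring: "1 < p \<Longrightarrow> cring (residue_ring p)"
  by (rule residues.cring) (simp add: residues_def)

lemma Units_residue_ring_prime:
  assumes "Factorial_Ring.prime (p :: nat)"
  shows "Units (residue_ring (int p)) = {1..int p - 1}"
  using residues_prime.res_prime_units_eq[of p] assms prime_gt_1_nat[OF assms]
  by (simp add: residues_prime_def of_nat_diff)

lemma card_nontrivial_sq_residue_ring_5:
  "card (nontrivial_sq (residue_ring 5)) = 2"
proof -
  have "Units (residue_ring 5) = {1..4}"
    using Units_residue_ring_prime[of 5] by simp
  moreover have "{1..4::int} = {1, 2, 3, 4}" by auto
  ultimately have "nontrivial_sq (residue_ring 5) = {2, 3}"
    by (auto simp: residue_ring_def)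
  then show ?thesis by simp
qed

lemma Units_residue_ring_2: "Units (residue_ring 2) = {\<one>\<^bsub>residue_ring 2\<^esub>}"
proof -
  have "Units (residue_ring 2) = {1..1}"
    using Units_residue_ring_prime[of 2] by simp
  then show ?thesis by (simp add: residue_ring_def)
qed

text \<open>Multiples of 1 define a homomorphism from the integers. It factors modulo
  \<open>p\<close> because the additive group has order \<open>p\<close>, Bezout gives injectivity
  on residues, and equal cardinalities give surjectivity.\<close>

lemma (in cring) card_prime_iso_residue_ring:
  assumes p: "Factorial_Ring.prime (p :: nat)" "card (carrier R) = p"
  shows "R \<simeq> residue_ring (int p)"
proof -
  have p1: "1 < int p" using p prime_gt_1_nat by fastforce
  interpret Z: cring "residue_ring (int p)" by (rule cring_residue_ring[OF p1])
  have one_zero: "\<one> \<noteq> \<zero>"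
  proof
    assume "\<one> = \<zero>"
    then have "carrier R = {\<zero>}" using one_zeroD by blast
    then show False using p prime_gt_1_nat[OF p(1)] by simp
  qed
  have p0: "[int p] \<cdot> \<one> = \<zero>"
    using group.pow_order_eq_1[OF a_group, of \<one>] p by (simp add: Coset.order_def add_pow_def int_pow_int)
  let ?f = "\<lambda>k::int. [k] \<cdot> \<one>"
  have add: "?f (k + l) = ?f k \<oplus> ?f l" for k l
    using add.int_pow_mult by simp
  have mult: "?f (k * l) = ?f k \<otimes> ?f l" for k l
    by (simp add: add_pow_ldistr_int add.int_pow_pow mult.commute)
  have pz: "?f (int p * k) = \<zero>" for k
    by (simp add: mult p0)
  have md: "?f (k mod int p) = ?f k" for k
  proof -
    have "?f k = ?f (int p * (k div int p) + k mod int p)" by simp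
    then show ?thesis unfolding add pz by simp
  qed
  have zero: "int p dvd k" if "?f k = \<zero>" for k
  proof (rule ccontr)
    assume "\<not> int p dvd k"
    then have "coprime (int p) k" using p(1) by (simp add: prime_imp_coprime)
    then obtain x y where "x * int p + y * k = 1"
      using bezout_int[of "int p" k] by (auto simp: coprime_iff_gcd_eq_1)
    then have "?f (x * int p + y * k) = \<one>" by simp
    then show False unfolding add mult that p0 using one_zero by simp
  qed
  have inj: "inj_on ?f (carrier (residue_ring (int p)))"
  proof (rule inj_onI)
    fix k l assume kl: "k \<in> carrier (residue_ring (int p))" "l \<in> carrier (residue_ring (int p))"
      and eq: "?f k = ?f l"
    have "?f (k + (- l)) \<oplus> ?f l = ?f k" unfolding add[symmetric] by simp
    then have "?f (k - l) = \<zero>"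
      using eq by (metis add.int_pow_closed add.r_cancel_one' one_closed uminus_add_conv_diff add.commute)
    then have "int p dvd k - l" by (rule zero)
    then have "k mod int p = l mod int p" by (simp add: mod_eq_dvd_iff)
    then show "k = l" using kl by (simp add: residue_ring_def)
  qed
  have fin: "finite (carrier R)" using p prime_gt_0_nat card_ge_0_finite by metis
  have "bij_betw ?f (carrier (residue_ring (int p))) (carrier R)"
    unfolding bij_betw_def
  proof (intro conjI inj card_subset_eq fin)
    show "card (?f ` carrier (residue_ring (int p))) = card (carrier R)"
      using card_image[OF inj] p by (simp add: residue_ring_def)
  qed auto
  then have "?f \<in> ring_iso (residue_ring (int p)) R"
    by (intro ring_iso_memI) (simp_all add: residue_ring_def md add mult)
  then show ?thesis
    using ring_iso_sym[OF Z.ring_axioms] by (auto simp: is_ring_iso_def)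
qed

text \<open>Evaluation at \<open>x\<close>; over \<open>\<int>/4\<close> the constant coefficient contributes its second binary digit to
  \<open>x\<^sup>2 = 2\<close>, and over \<open>\<int>/2\<close> that digit is 0.\<close>

definition cubic_proj :: "int \<Rightarrow> (nat \<Rightarrow> int) \<Rightarrow> bool \<times> bool \<times> bool" where
  "cubic_proj k p = (let c = up_ring.coeff (UP (residue_ring k)) p in
     (odd (c 0), odd (c 1), odd (c 2) \<noteq> odd (c 0 div 2)))"

lemma even_mod: "even k \<Longrightarrow> even (x mod k) \<longleftrightarrow> even (x :: int)"
  by (simp add: dvd_mod_iff)

text \<open>Modulo 4, adding two odd residues carries into the second binary digit. Modulo 2 there
  is no such digit, which the conjunct \<open>k = 4\<close> expresses.\<close>

lemma carry_add:
  assumes "k = 2 \<or> k = 4" "x \<in> {0..<k}" "y \<in> {0..<k}"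
  shows "odd ((x + y) mod k div (2::int)) \<longleftrightarrow>
    (odd (x div 2) \<noteq> odd (y div 2)) \<noteq> (k = 4 \<and> odd x \<and> odd y)"
proof -
  have "(k = 2 \<and> z \<in> {0, 1}) \<or> (k = 4 \<and> z \<in> {0, 1, 2, 3})" if "z \<in> {0..<k}" for z
    using that assms(1) by auto
  from this[OF assms(2)] this[OF assms(3)] show ?thesis
    by (elim disjE conjE insertE emptyE; simp)
qed

text \<open>Modulo 4 the product of the two high digits drops out, so the second digit is the sum of
  the mixed products.\<close>

lemma carry_mult:
  assumes "k = 2 \<or> k = 4" "x \<in> {0..<k}" "y \<in> {0..<k}"
  shows "odd ((x * y) mod k div (2::int)) \<longleftrightarrow>
    (odd x \<and> odd (y div 2)) \<noteq> (odd (x div 2) \<and> odd y)"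
proof -
  have "(k = 2 \<and> z \<in> {0, 1}) \<or> (k = 4 \<and> z \<in> {0, 1, 2, 3})" if "z \<in> {0..<k}" for z
    using that assms(1) by auto
  from this[OF assms(2)] this[OF assms(3)] show ?thesis
    by (elim disjE conjE insertE emptyE; simp)
qed

text \<open>Since \<open>k\<close> is even, reduction modulo \<open>k\<close> preserves parities.
  The carry lemmas handle the extra digit of the constant coefficient; only coefficients up to
  degree 2 enter.\<close>

lemma ring_hom_cubic_proj:
  assumes k: "k = 2 \<or> k = 4"
  shows "ring_hom_ring (UP (residue_ring k)) (cubic_ring (k = 4)) (cubic_proj k)"
proof -
  interpret Z: residues k "residue_ring k" using k by unfold_locales auto
  interpret P: UP_cring "residue_ring k" "UP (residue_ring k)"
    by unfold_locales
  let ?P = "UP (residue_ring k)"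
  interpret T: cring "cubic_ring (k = 4)" by (rule cring_cubic_ring)
  have ek: "even k" using k by auto
  have cc: "up_ring.coeff ?P p i \<in> {0..<k}" if "p \<in> carrier ?P" for p i
    using P.coeff_closed[OF that, of i] by (auto simp: residue_ring_def)
  show ?thesis
  proof (intro ring_hom_ringI)
    show "ring ?P" "ring (cubic_ring (k = 4))"
      using P.UP_ring T.ring_axioms by auto
    show "cubic_proj k p \<in> carrier (cubic_ring (k = 4))" for p
      by (simp add: cubic_ring_def)
    show "cubic_proj k \<one>\<^bsub>?P\<^esub> = \<one>\<^bsub>cubic_ring (k = 4)\<^esub>"
      by (simp add: cubic_proj_def cubic_ring_def Z.res_one_eq Z.res_zero_eq Let_def)
    fix p q assume pq: "p \<in> carrier ?P" "q \<in> carrier ?P"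
    note c = cc[OF pq(1)] cc[OF pq(2)]
    have "up_ring.coeff ?P (p \<oplus>\<^bsub>?P\<^esub> q) i = (up_ring.coeff ?P p i + up_ring.coeff ?P q i) mod k" for i
      using pq by (simp add: Z.res_add_eq)
    then show "cubic_proj k (p \<oplus>\<^bsub>?P\<^esub> q) = cubic_proj k p \<oplus>\<^bsub>cubic_ring (k = 4)\<^esub> cubic_proj k q"
      using carry_add[OF k c(1)[of 0] c(2)[of 0]]
      unfolding cubic_proj_def Let_def by (simp add: cubic_ring_def even_mod[OF ek]) (smt (verit))
    have m0: "up_ring.coeff ?P (p \<otimes>\<^bsub>?P\<^esub> q) 0 = (up_ring.coeff ?P p 0 * up_ring.coeff ?P q 0) mod k"
      using pq by (simp add: Z.res_mult_eq)
    have m1: "up_ring.coeff ?P (p \<otimes>\<^bsub>?P\<^esub> q) 1 = (up_ring.coeff ?P p 1 * up_ring.coeff ?P q 0 + up_ring.coeff ?P p 0 * up_ring.coeff ?P q 1) mod k"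
      using pq by (simp add: Z.res_mult_eq Z.res_add_eq Z.res_zero_eq mod_simps)
    have m2: "up_ring.coeff ?P (p \<otimes>\<^bsub>?P\<^esub> q) 2 =
      (up_ring.coeff ?P p 2 * up_ring.coeff ?P q 0 + (up_ring.coeff ?P p 1 * up_ring.coeff ?P q 1 + up_ring.coeff ?P p 0 * up_ring.coeff ?P q 2)) mod k"
      using pq by (simp add: Z.res_mult_eq Z.res_add_eq Z.res_zero_eq mod_simps numeral_2_eq_2)
    show "cubic_proj k (p \<otimes>\<^bsub>?P\<^esub> q) = cubic_proj k p \<otimes>\<^bsub>cubic_ring (k = 4)\<^esub> cubic_proj k q"
      using carry_mult[OF k c(1)[of 0] c(2)[of 0]]
      unfolding cubic_proj_def Let_def m0 m1 m2 by (simp add: cubic_ring_def even_mod[OF ek]) (smt (verit))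
  qed
qed

lemma cubic_proj_surj:
  assumes k: "k = 2 \<or> k = 4"
  shows "cubic_proj k ` carrier (UP (residue_ring k)) = carrier (cubic_ring (k = 4))"
proof -
  interpret Z: residues k "residue_ring k" using k by unfold_locales auto
  interpret P: UP_cring "residue_ring k" "UP (residue_ring k)"
    by unfold_locales
  let ?P = "UP (residue_ring k)"
  have "(a, b, c) \<in> cubic_proj k ` carrier ?P" for a b c
  proof
    \<comment> \<open>Coefficients 0 and 1 have no second binary digit, so the constant term does
      not disturb the coefficient of \<open>x\<^sup>2\<close>.\<close>
    let ?p = "up_ring.monom ?P (of_bool a) 0 \<oplus>\<^bsub>?P\<^esub> (up_ring.monom ?P (of_bool b) 1 \<oplus>\<^bsub>?P\<^esub> up_ring.monom ?P (of_bool c) 2)"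
    have cl: "of_bool x \<in> carrier (residue_ring k)" for x
      using k by (auto simp: residue_ring_def)
    show "?p \<in> carrier ?P" using cl by simp
    show "(a, b, c) = cubic_proj k ?p"
      using k cl by (auto simp: cubic_proj_def Z.res_add_eq Z.res_zero_eq)
  qed
  then show ?thesis by (auto simp: cubic_ring_def)
qed

text \<open>Division by the cube of the variable, with the coefficient sequence shifted by three as
  quotient. It reduces the kernel computations to the first three coefficients.\<close>

lemma (in UP_cring) monom_decomposition:
  assumes p: "p \<in> carrier P"
  shows "\<exists>q\<in>carrier P. p = (up_ring.monom P (up_ring.coeff P p 0) 0 \<oplus>\<^bsub>P\<^esub> (up_ring.monom P (up_ring.coeff P p 1) 1 \<oplus>\<^bsub>P\<^esub> up_ring.monom P (up_ring.coeff P p 2) 2))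
    \<oplus>\<^bsub>P\<^esub> up_ring.monom P \<one> 3 \<otimes>\<^bsub>P\<^esub> q"
proof
  define q where "q = (\<lambda>i. up_ring.coeff P p (i + 3))"
  have coeff_eq: "up_ring.coeff P f i = f i" if "f \<in> up R" for f i
    using that unfolding P_def UP_def by simp
  have carrier_eq: "carrier P = up R" unfolding P_def UP_def by simp
  then have pup: "p \<in> up R" using p by simp
  then obtain n where n: "bound \<zero> n p" by blast
  have up: "q \<in> up R"
  proof (rule mem_upI)
    show "q i \<in> carrier R" for i using p by (simp add: q_def)
    show "\<exists>n. bound \<zero> n q" 
      using n by (intro exI[of _ n] bound.intro) (simp add: q_def coeff_eq[OF pup] bound.bound)
  qed
  then show qP: "q \<in> carrier P" by (simp add: carrier_eq)
  have cq: "up_ring.coeff P q i = up_ring.coeff P p (i + 3)" for i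
    using coeff_eq[OF up] by (simp add: q_def)
  have low: "up_ring.coeff P (up_ring.monom P \<one> 3 \<otimes>\<^bsub>P\<^esub> q) i = \<zero>" if "i < 3" for i
  proof -
    have "up_ring.coeff P (up_ring.monom P \<one> 3 \<otimes>\<^bsub>P\<^esub> q) i = (\<Oplus>j \<in> {..i}. \<zero>)"
      using qP that by (simp only: coeff_mult[OF monom_closed[OF R.one_closed] qP])
        (intro R.finsum_cong', auto)
    then show ?thesis by simp
  qed
  have high: "up_ring.coeff P (up_ring.monom P \<one> 3 \<otimes>\<^bsub>P\<^esub> q) (3 + i) = up_ring.coeff P p (3 + i)" for i
    using coeff_monom_mult[OF R.one_closed qP, of 3 i] p by (simp add: cq add.commute)
  show "p = (up_ring.monom P (up_ring.coeff P p 0) 0 \<oplus>\<^bsub>P\<^esub> (up_ring.monom P (up_ring.coeff P p 1) 1 \<oplus>\<^bsub>P\<^esub> up_ring.monom P (up_ring.coeff P p 2) 2))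
    \<oplus>\<^bsub>P\<^esub> up_ring.monom P \<one> 3 \<otimes>\<^bsub>P\<^esub> q" (is "p = ?r")
  proof (rule up_eqI)
    fix i
    show "up_ring.coeff P p i = up_ring.coeff P ?r i"
    proof (cases "i < 3")
      case True
      then consider "i = 0" | "i = 1" | "i = 2" by linarith
      then show ?thesis using p qP low[OF True] by cases simp_all
    next
      case False
      then obtain j where "i = 3 + j" using le_Suc_ex not_less by blast
      then show ?thesis using p qP high[of j] by simp
    qed
  qed (use p qP in simp_all)
qed

lemma cubic_proj_eq_zero_iff:
  "cubic_proj k p = \<zero>\<^bsub>cubic_ring \<kappa>\<^esub> \<longleftrightarrow>
     (let c = up_ring.coeff (UP (residue_ring k)) p in
        even (c 0) \<and> even (c 1) \<and> (odd (c 2) \<longleftrightarrow> odd (c 0 div 2)))"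
  by (auto simp: cubic_proj_def cubic_ring_def Let_def)

text \<open>Over two elements, a polynomial in the kernel of the evaluation has its first three
  coefficients zero, so it is a multiple of the generator. The first isomorphism theorem does the
  rest.\<close>

lemma Z2_X_mod_X3_iso:
  shows "Z2_X_mod_X3 \<simeq> cubic_ring False" "cubic_ring False \<simeq> Z2_X_mod_X3"
proof -
  interpret Z: residues 2 "residue_ring 2" by unfold_locales auto
  interpret P: UP_cring "residue_ring 2" "UP (residue_ring 2)"
    by unfold_locales
  let ?P = "UP (residue_ring 2)" and ?h = "cubic_proj 2"
  let ?x3 = "up_ring.monom ?P 1 3"
  have h: "ring_hom_ring ?P (cubic_ring False) ?h"
    using ring_hom_cubic_proj[of 2] by simp
  have one: "1 \<in> carrier (residue_ring 2)" by (simp add: Z.res_carrier_eq)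
  then have x3: "?x3 \<in> carrier ?P" by simp
  have I: "ideal (Idl\<^bsub>?P\<^esub> {?x3}) ?P" using x3 by (intro P.P.genideal_ideal) auto
  have "a_kernel ?P (cubic_ring False) ?h = Idl\<^bsub>?P\<^esub> {?x3}"
  proof
    show "Idl\<^bsub>?P\<^esub> {?x3} \<subseteq> a_kernel ?P (cubic_ring False) ?h"
    proof (rule P.P.genideal_minimal[OF ring_hom_ring.kernel_is_ideal[OF h]])
      show "{?x3} \<subseteq> a_kernel ?P (cubic_ring False) ?h"
        using x3 one by (simp add: a_kernel_def' cubic_proj_eq_zero_iff Let_def Z.res_zero_eq)
    qed
    show "a_kernel ?P (cubic_ring False) ?h \<subseteq> Idl\<^bsub>?P\<^esub> {?x3}"
    proof
      fix p assume "p \<in> a_kernel ?P (cubic_ring False) ?h"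
      then have p: "p \<in> carrier ?P" "?h p = \<zero>\<^bsub>cubic_ring False\<^esub>" by (auto simp: a_kernel_def')
      have c: "up_ring.coeff ?P p i = 0 \<or> up_ring.coeff ?P p i = 1" for i
        using P.coeff_closed[OF p(1), of i] by (auto simp: Z.res_carrier_eq)
      have "up_ring.coeff ?P p 0 = 0" "up_ring.coeff ?P p 1 = 0" "up_ring.coeff ?P p 2 = 0"
        using p(2) c[of 0] c[of 1] c[of 2] unfolding cubic_proj_eq_zero_iff Let_def by auto
      then obtain q where "q \<in> carrier ?P" "p = ?x3 \<otimes>\<^bsub>?P\<^esub> q"
        using P.monom_decomposition[OF p(1)] x3 P.monom_zero by (auto simp: Z.res_one_eq Z.res_zero_eq)
      then show "p \<in> Idl\<^bsub>?P\<^esub> {?x3}"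
        using ideal.I_r_closed[OF I] P.P.genideal_self'[OF x3] by auto
    qed
  qed
  then have Q: "Z2_X_mod_X3 = ?P Quot a_kernel ?P (cubic_ring False) ?h"
    by (simp add: Z2_X_mod_X3_def Let_def)
  show iso: "Z2_X_mod_X3 \<simeq> cubic_ring False"
    unfolding Q using ring_hom_ring.FactRing_iso[OF h] cubic_proj_surj[of 2] by simp
  have "ring Z2_X_mod_X3"
    unfolding Q by (intro ideal.quotient_is_ring ring_hom_ring.kernel_is_ideal[OF h])
  then show "cubic_ring False \<simeq> Z2_X_mod_X3"
    using iso ring_iso_sym by blast
qed

text \<open>The kernel is spanned by \<open>2x\<close>, \<open>x\<^sup>2 - 2\<close> and
  \<open>x\<^sup>3\<close>, and the last already lies in the ideal of the first two. The claim
  follows from the first isomorphism theorem.\<close>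

lemma Z4_X_mod_2X_X2_minus_2_iso:
  shows "Z4_X_mod_2X_X2_minus_2 \<simeq> cubic_ring True" "cubic_ring True \<simeq> Z4_X_mod_2X_X2_minus_2"
proof -
  interpret Z: residues 4 "residue_ring 4" by unfold_locales auto
  interpret P: UP_cring "residue_ring 4" "UP (residue_ring 4)"
    by unfold_locales
  let ?P = "UP (residue_ring 4)" and ?h = "cubic_proj 4"
  let ?m = "up_ring.monom ?P"
  let ?g = "?m 1 2 \<ominus>\<^bsub>?P\<^esub> ?m 2 0"
  have h: "ring_hom_ring ?P (cubic_ring True) ?h"
    using ring_hom_cubic_proj[of 4] by simp
  have num: "0 \<in> carrier (residue_ring 4)" "1 \<in> carrier (residue_ring 4)"
    "2 \<in> carrier (residue_ring 4)" "3 \<in> carrier (residue_ring 4)"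
    by (auto simp: Z.res_carrier_eq)
  have cl: "?m 2 1 \<in> carrier ?P" "?g \<in> carrier ?P" "?m 1 3 \<in> carrier ?P"
    using num by auto
  define I where "I = Idl\<^bsub>?P\<^esub> {?m 2 1, ?g}"
  have "ideal I ?P" unfolding I_def using cl by (intro P.P.genideal_ideal) auto
  interpret I: ideal I ?P by fact
  have gens: "?m 2 1 \<in> I" "?g \<in> I"
    using P.P.genideal_self[of "{?m 2 1, ?g}"] cl by (auto simp: I_def)
  have gmult: "?m a n \<otimes>\<^bsub>?P\<^esub> ?g = ?m a (n + 2) \<oplus>\<^bsub>?P\<^esub> ?m ((- 2 * a) mod 4) n"
    if a: "a \<in> carrier (residue_ring 4)" for a n
  proof -
    have "?m a n \<otimes>\<^bsub>?P\<^esub> ?g = ?m a n \<otimes>\<^bsub>?P\<^esub> ?m 1 2 \<ominus>\<^bsub>?P\<^esub> ?m a n \<otimes>\<^bsub>?P\<^esub> ?m 2 0"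
      using a num by (simp add: a_minus_def P.P.r_distr P.P.r_minus)
    also have "?m a n \<otimes>\<^bsub>?P\<^esub> ?m 1 2 = ?m a (n + 2)"
      using P.monom_mult[OF a num(2), of n 2] a by (simp add: Z.res_mult_eq Z.res_carrier_eq)
    also have "?m a n \<otimes>\<^bsub>?P\<^esub> ?m 2 0 = ?m ((a * 2) mod 4) n"
      using P.monom_mult[OF a num(3), of n 0] by (simp add: Z.res_mult_eq)
    also have "?m a (n + 2) \<ominus>\<^bsub>?P\<^esub> ?m ((a * 2) mod 4) n = ?m a (n + 2) \<oplus>\<^bsub>?P\<^esub> ?m (\<ominus>\<^bsub>residue_ring 4\<^esub> ((a * 2) mod 4)) n"
      by (subst P.monom_a_inv) (auto simp: a_minus_def Z.res_carrier_eq)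
    also have "\<ominus>\<^bsub>residue_ring 4\<^esub> ((a * 2) mod 4) = (- 2 * a) mod 4"
      by (simp add: Z.res_neg_eq mod_simps mult.commute)
    finally show ?thesis .
  qed
  have z: "?m 0 n = \<zero>\<^bsub>?P\<^esub>" for n using P.monom_zero[of n] by (simp add: Z.res_zero_eq)
  \<comment> \<open>Multiplying \<open>x\<^sup>2 - 2\<close> by \<open>x\<close> gives
    \<open>x\<^sup>3 + 2x\<close>, as -2 equals 2 modulo 4; now subtract the generator
    \<open>2x\<close>.\<close>
  have x3: "?m 1 3 \<in> I"
  proof -
    have "?m 1 1 \<otimes>\<^bsub>?P\<^esub> ?g = ?m 1 3 \<oplus>\<^bsub>?P\<^esub> ?m 2 1"
      using gmult[OF num(2), of 1] by (simp add: numeral_3_eq_3 numeral_2_eq_2)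
    then have "?m 1 3 \<oplus>\<^bsub>?P\<^esub> ?m 2 1 \<in> I"
      using I.I_l_closed[OF gens(2), of "?m 1 1"] num by simp
    then have "(?m 1 3 \<oplus>\<^bsub>?P\<^esub> ?m 2 1) \<ominus>\<^bsub>?P\<^esub> ?m 2 1 \<in> I"
      using gens(1) by (simp add: a_minus_def)
    moreover have "(?m 1 3 \<oplus>\<^bsub>?P\<^esub> ?m 2 1) \<ominus>\<^bsub>?P\<^esub> ?m 2 1 = ?m 1 3"
      using cl by (simp add: a_minus_def P.P.a_assoc P.P.r_neg)
    ultimately show ?thesis by simp
  qed
  have "a_kernel ?P (cubic_ring True) ?h = I"
  proof
    show "I \<subseteq> a_kernel ?P (cubic_ring True) ?h"
      unfolding I_def
    proof (rule P.P.genideal_minimal[OF ring_hom_ring.kernel_is_ideal[OF h]])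
      have "up_ring.coeff ?P ?g 0 = 2" "up_ring.coeff ?P ?g 1 = 0" "up_ring.coeff ?P ?g 2 = 1"
        using num by (simp_all add: P.coeff_minus a_minus_def[of "residue_ring 4"] Z.res_neg_eq Z.res_add_eq Z.res_zero_eq)
      then have "?h ?g = \<zero>\<^bsub>cubic_ring True\<^esub>"
        unfolding cubic_proj_eq_zero_iff Let_def by simp
      moreover have "?h (?m 2 1) = \<zero>\<^bsub>cubic_ring True\<^esub>"
        using num by (simp add: cubic_proj_eq_zero_iff Let_def Z.res_zero_eq)
      ultimately show "{?m 2 1, ?g} \<subseteq> a_kernel ?P (cubic_ring True) ?h"
        using cl by (simp add: a_kernel_def')
    qed
    show "a_kernel ?P (cubic_ring True) ?h \<subseteq> I"
    proof
      fix p assume "p \<in> a_kernel ?P (cubic_ring True) ?h"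
      then have p: "p \<in> carrier ?P" "?h p = \<zero>\<^bsub>cubic_ring True\<^esub>" by (auto simp: a_kernel_def')
      let ?c = "up_ring.coeff ?P p"
      have cc: "?c i \<in> carrier (residue_ring 4)" for i using P.coeff_closed[OF p(1)] .
      have c: "?c i = 0 \<or> ?c i = 1 \<or> ?c i = 2 \<or> ?c i = 3" for i
        using cc[of i] by (auto simp: Z.res_carrier_eq)
      obtain q where q: "q \<in> carrier ?P"
        "p = (?m (?c 0) 0 \<oplus>\<^bsub>?P\<^esub> (?m (?c 1) 1 \<oplus>\<^bsub>?P\<^esub> ?m (?c 2) 2)) \<oplus>\<^bsub>?P\<^esub> ?m 1 3 \<otimes>\<^bsub>?P\<^esub> q"
        using P.monom_decomposition[OF p(1)] by (auto simp: Z.res_one_eq)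
      have "?c 1 = 0 \<or> ?c 1 = 2"
        using p(2) c[of 1] unfolding cubic_proj_eq_zero_iff Let_def by auto
      then have c1: "?m (?c 1) 1 \<in> I"
        using gens(1) z by auto
      \<comment> \<open>The kernel condition makes the constant coefficient 2 exactly when the
        quadratic one is odd, so these two terms form a multiple of
        \<open>x\<^sup>2 - 2\<close>.\<close>
      have "?c 0 = (- 2 * ?c 2) mod 4"
        using p(2) c[of 0] c[of 2] unfolding cubic_proj_eq_zero_iff Let_def by auto
      then have "?m (?c 0) 0 \<oplus>\<^bsub>?P\<^esub> ?m (?c 2) 2 = ?m (?c 2) 0 \<otimes>\<^bsub>?P\<^esub> ?g"
        using gmult[OF cc[of 2], of 0] cc by (simp add: P.P.a_comm flip: numeral_2_eq_2)
      then have c02: "?m (?c 0) 0 \<oplus>\<^bsub>?P\<^esub> ?m (?c 2) 2 \<in> I"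
        using I.I_l_closed[OF gens(2)] cc by simp
      have "p = ((?m (?c 0) 0 \<oplus>\<^bsub>?P\<^esub> ?m (?c 2) 2) \<oplus>\<^bsub>?P\<^esub> ?m (?c 1) 1) \<oplus>\<^bsub>?P\<^esub> ?m 1 3 \<otimes>\<^bsub>?P\<^esub> q"
        by (rule trans[OF q(2)]) (use cc cl q(1) in \<open>simp add: P.P.a_ac\<close>)
      also have "\<dots> \<in> I"
        by (rule I.a_closed[OF I.a_closed[OF c02 c1] I.I_r_closed[OF x3 q(1)]])
      finally show "p \<in> I" .
    qed
  qed
  then have Q: "Z4_X_mod_2X_X2_minus_2 = ?P Quot a_kernel ?P (cubic_ring True) ?h"
    by (simp add: Z4_X_mod_2X_X2_minus_2_def Let_def I_def)
  show iso: "Z4_X_mod_2X_X2_minus_2 \<simeq> cubic_ring True"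
    unfolding Q using ring_hom_ring.FactRing_iso[OF h] cubic_proj_surj[of 4] by simp
  have "ring Z4_X_mod_2X_X2_minus_2"
    unfolding Q by (intro ideal.quotient_is_ring ring_hom_ring.kernel_is_ideal[OF h])
  then show "cubic_ring True \<simeq> Z4_X_mod_2X_X2_minus_2"
    using iso ring_iso_sym by blast
qed

section \<open>Local rings with few units\<close>

context cring
begin

text \<open>A Boolean used as a coefficient 0 or 1, linking the Boolean tuples of the model rings to
  linear combinations in \<open>R\<close>.\<close>

definition bit :: "bool \<Rightarrow> 'a \<Rightarrow> 'a" where
  "bit b v = (if b then v else \<zero>)"

lemma bit_closed: "v \<in> carrier R \<Longrightarrow> bit b v \<in> carrier R"
  by (simp add: bit_def)

lemma bit_zero: "bit b \<zero> = \<zero>"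
  by (simp add: bit_def)

lemma bit_add: "\<lbrakk>v \<in> carrier R; v \<oplus> v = \<zero>\<rbrakk> \<Longrightarrow> bit p v \<oplus> bit q v = bit (p \<noteq> q) v"
  by (auto simp: bit_def)

lemma bit_mult: "\<lbrakk>u \<in> carrier R; v \<in> carrier R\<rbrakk> \<Longrightarrow> bit p u \<otimes> bit q v = bit (p \<and> q) (u \<otimes> v)"
  by (auto simp: bit_def)

end

section \<open>Comparing the unit group with the maximal ideal\<close>

context finite_local_ring
begin

lemma unit_mult_eq_zero:
  assumes "u \<in> Units R" "x \<in> carrier R" "u \<otimes> x = \<zero>"
  shows "x = \<zero>"
  using assms by (metis Units_closed Units_l_cancel r_null zero_closed)

lemma nonunits_closed: "m \<in> nonunits \<Longrightarrow> m \<in> carrier R"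
  by (simp add: nonunits_def)

lemma finite_nonunits: "finite nonunits"
  using finite_carrier by (simp add: nonunits_def)

lemma finite_Units: "finite (Units R)"
  by (rule finite_subset[OF _ finite_carrier]) (auto simp: Units_def)

lemma carrier_eq: "carrier R = Units R \<union> nonunits"
  using Units_closed by (auto simp: nonunits_def)

lemma card_carrier: "card (carrier R) = card (Units R) + card nonunits"
proof -
  have "Units R \<inter> nonunits = {}" by (auto simp: nonunits_def)
  then show ?thesis
    unfolding carrier_eq using finite_nonunits finite_Units by (simp add: card_Un_disjoint)
qed

text \<open>By Lagrange the size of the maximal ideal divides that of the ring, hence also the
  difference, which is the number of units.\<close>

lemma card_nonunits_dvd: "card nonunits dvd card (Units R)"
proof -
  have "card (rcosets\<^bsub>add_monoid R\<^esub> nonunits) * card nonunits = card (carrier R)"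
    using group.lagrange_finite[OF a_group _ N.a_subgroup] finite_carrier
    by (simp add: Coset.order_def)
  then have "card nonunits dvd card (carrier R)" by (metis dvd_triv_right)
  then show ?thesis
    unfolding card_carrier by simp
qed

lemma card_nonunits_le: "card nonunits \<le> card (Units R)"
proof (rule dvd_imp_le[OF card_nonunits_dvd])
  show "0 < card (Units R)"
    using Units_one_closed finite_Units by (auto simp: card_gt_0_iff)
qed

text \<open>The translate of the maximal ideal by 1 consists of units and has as many elements as
  there are units, so it is the whole unit group.\<close>

lemma unit_minus_one:
  assumes "card nonunits = card (Units R)" "u \<in> Units R"
  shows "u \<ominus> \<one> \<in> nonunits"
proof -
  have "inj_on (\<lambda>m. \<one> \<oplus> m) nonunits"
    by (auto simp: inj_on_def nonunits_def)
  then have "card ((\<lambda>m. \<one> \<oplus> m) ` nonunits) = card (Units R)"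
    using assms(1) by (simp add: card_image)
  then have "(\<lambda>m. \<one> \<oplus> m) ` nonunits = Units R"
    using one_add_nonunit finite_Units by (intro card_subset_eq) auto
  then obtain m where m: "m \<in> nonunits" "u = \<one> \<oplus> m" using assms by blast
  then have "u \<ominus> \<one> = m" using nonunits_closed[OF m(1)] by algebra
  then show ?thesis using m by simp
qed

text \<open>Apply the previous fact to the unit -1 and negate.\<close>

lemma two_nonunit:
  assumes "card nonunits = card (Units R)"
  shows "\<one> \<oplus> \<one> \<in> nonunits"
proof -
  have "\<ominus> (\<ominus> \<one> \<ominus> \<one>) \<in> nonunits"
    by (intro N.a_inv_closed unit_minus_one[OF assms] Units_minus_one_closed)
  moreover have "\<ominus> (\<ominus> \<one> \<ominus> \<one>) = \<one> \<oplus> \<one>" by algebra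
  ultimately show ?thesis by simp
qed

text \<open>The size of the maximal ideal divides 1, so the ring has two elements.\<close>

lemma iso_residue_ring_2:
  assumes "Units R = {\<one>}"
  shows "R \<simeq> residue_ring 2"
proof -
  have "card nonunits dvd 1" using card_nonunits_dvd assms by simp
  then have "card (carrier R) = 2" unfolding card_carrier using assms by simp
  then show ?thesis using card_prime_iso_residue_ring[of 2] by simp
qed

lemma nonunits_eq_zero:
  assumes "card nonunits = 1" shows "nonunits = {\<zero>}"
proof -
  obtain x where "nonunits = {x}" using assms by (rule card_1_singletonE)
  then show ?thesis using N.zero_closed by simp
qed

text \<open>The size of the maximal ideal divides 3. Once 3 is excluded, the ring is
  \<open>{0, 1, a, a\<^sup>2}\<close> of characteristic 2 with
  \<open>a\<^sup>2 = 1 + a\<close>.\<close>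

lemma iso_F4:
  assumes U: "Units R = {\<one>, a, a \<otimes> a}" and a3: "a \<otimes> (a \<otimes> a) = \<one>" and ne: "a \<otimes> a \<noteq> \<one>"
  shows "R \<simeq> F4"
proof -
  have aU: "a \<in> Units R" using U by simp
  have ac: "a \<in> carrier R" using aU by (rule Units_closed)
  have a1: "a \<noteq> \<one>" using ne by auto
  have aa: "a \<otimes> a \<noteq> a" using a1 aU ac by (metis Units_l_cancel one_closed r_one)
  have cU: "card (Units R) = 3" using U a1 aa ne by auto
  have "card nonunits dvd 3" using card_nonunits_dvd cU by simp
  moreover have "card nonunits \<le> 3" using card_nonunits_le cU by simp
  then have "card nonunits \<in> {0, 1, 2, 3}" by auto
  ultimately have "card nonunits = 1 \<or> card nonunits = 3" by auto
  moreover have "card nonunits \<noteq> 3"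
  proof
    assume "card nonunits = 3"
    then have eq: "card nonunits = card (Units R)" using cU by simp
    \<comment> \<open>Adding 1 to this nonunit gives \<open>1 + a + a\<^sup>2\<close>, a unit whose
      product with \<open>a - 1\<close> is \<open>a\<^sup>3 - 1 = 0\<close>.\<close>
    have "(a \<otimes> a \<ominus> \<one>) \<oplus> ((a \<ominus> \<one>) \<oplus> (\<one> \<oplus> \<one>)) \<in> nonunits"
      using U by (intro N.a_closed[OF unit_minus_one[OF eq] N.a_closed[OF unit_minus_one[OF eq] two_nonunit[OF eq]]]) auto
    then have "\<one> \<oplus> ((a \<otimes> a \<ominus> \<one>) \<oplus> ((a \<ominus> \<one>) \<oplus> (\<one> \<oplus> \<one>))) \<in> Units R"
      by (rule one_add_nonunit)
    moreover have "(\<one> \<oplus> ((a \<otimes> a \<ominus> \<one>) \<oplus> ((a \<ominus> \<one>) \<oplus> (\<one> \<oplus> \<one>)))) \<otimes> (a \<ominus> \<one>) = a \<otimes> (a \<otimes> a) \<ominus> \<one>"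
      using ac by algebra
    ultimately have "a \<ominus> \<one> = \<zero>"
      using unit_mult_eq_zero[of _ "a \<ominus> \<one>"] ac a3 by simp
    then show False using a1 ac by simp
  qed
  ultimately have N: "nonunits = {\<zero>}" using nonunits_eq_zero by blast
  have car: "carrier R = {\<zero>, \<one>, a, a \<otimes> a}"
    unfolding carrier_eq N U by auto
  have ccar: "card (carrier R) = 4" unfolding card_carrier cU N by simp
  \<comment> \<open>The unit -1 has square 1, whereas \<open>a\<close> and
    \<open>a \<otimes> a\<close> do not.\<close>
  have "\<ominus> \<one> = \<one>"
  proof -
    have "\<ominus> \<one> \<otimes> \<ominus> \<one> = \<one>" by (simp add: l_minus r_minus)
    moreover have "(a \<otimes> a) \<otimes> (a \<otimes> a) \<noteq> \<one>"
    proof -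
      have "(a \<otimes> a) \<otimes> (a \<otimes> a) = a \<otimes> (a \<otimes> (a \<otimes> a))" using ac by (simp add: m_assoc)
      then show ?thesis using a3 a1 ac by simp
    qed
    ultimately show ?thesis using Units_minus_one_closed ne unfolding U by auto
  qed
  then have two: "\<one> \<oplus> \<one> = \<zero>" by (metis one_closed r_neg)
  have dbl: "x \<oplus> x = \<zero>" if "x \<in> carrier R" for x
  proof -
    have "x \<oplus> x = (\<one> \<oplus> \<one>) \<otimes> x" using that by algebra
    then show ?thesis using two that by simp
  qed
  have dbl': "x \<oplus> (x \<oplus> y) = y" if "x \<in> carrier R" "y \<in> carrier R" for x y
    using that dbl by (simp flip: a_assoc)
  \<comment> \<open>By elimination: \<open>\<one> \<oplus> a\<close> differs from 0, 1 and
    \<open>a\<close>, leaving one element of the carrier.\<close>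
  have a2: "a \<otimes> a = \<one> \<oplus> a"
  proof -
    have "\<one> \<oplus> a \<in> {\<zero>, \<one>, a, a \<otimes> a}" unfolding car[symmetric] using ac by simp
    moreover have "\<one> \<oplus> a \<noteq> \<zero>" using a1 dbl'[of \<one> a] ac by auto
    moreover have "\<one> \<oplus> a \<noteq> \<one>" using aU zero_not_unit ac by auto
    moreover have "\<one> \<oplus> a \<noteq> a" using one_ne_zero ac by auto
    ultimately show ?thesis by auto
  qed
  define g where "g = (\<lambda>(x, y). bit x \<one> \<oplus> bit y a)"
  have surj: "g ` UNIV = carrier R"
  proof
    have "\<zero> = g (False, False)" "\<one> = g (True, False)" "a = g (False, True)" "a \<otimes> a = g (True, True)"
      using ac a2 by (simp_all add: g_def bit_def)
    then show "carrier R \<subseteq> g ` UNIV" unfolding car by blast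
  qed (use ac in \<open>auto simp: g_def bit_closed\<close>)
  then have "inj g"
    using ccar by (intro eq_card_imp_inj_on) (auto simp flip: UNIV_Times_UNIV)
  then have "bij_betw g (carrier F4) (carrier R)"
    using surj by (simp add: bij_betw_def F4_def)
  moreover have "g (x \<oplus>\<^bsub>F4\<^esub> y) = g x \<oplus> g y \<and> g (x \<otimes>\<^bsub>F4\<^esub> y) = g x \<otimes> g y" for x y
  proof -
    obtain x0 x1 y0 y1 where xy: "x = (x0, x1)" "y = (y0, y1)" by (metis surj_pair)
    note cl = bit_closed[OF one_closed] bit_closed[OF ac]
    note add = bit_add[OF one_closed two] bit_add[OF ac dbl[OF ac]]
    have "g x \<oplus> g y = (bit x0 \<one> \<oplus> bit y0 \<one>) \<oplus> (bit x1 a \<oplus> bit y1 a)"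
      unfolding xy g_def using cl by (simp add: a_ac)
    also have "\<dots> = g (x \<oplus>\<^bsub>F4\<^esub> y)"
      unfolding add xy by (simp add: F4_def g_def)
    finally have 1: "g (x \<oplus>\<^bsub>F4\<^esub> y) = g x \<oplus> g y" ..
    have split: "bit b (\<one> \<oplus> a) = bit b \<one> \<oplus> bit b a" for b
      by (simp add: bit_def)
    have "g x \<otimes> g y = bit x0 \<one> \<otimes> bit y0 \<one> \<oplus> (bit x1 a \<otimes> bit y1 a \<oplus>
        (bit x0 \<one> \<otimes> bit y1 a \<oplus> bit x1 a \<otimes> bit y0 \<one>))"
      unfolding xy g_def using cl by (simp add: l_distr r_distr a_ac)
    also have "\<dots> = bit (x0 \<and> y0) \<one> \<oplus> ((bit (x1 \<and> y1) \<one> \<oplus> bit (x1 \<and> y1) a) \<oplus>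
        (bit (x0 \<and> y1) a \<oplus> bit (x1 \<and> y0) a))"
      using ac by (simp add: bit_mult a2 split)
    also have "\<dots> = (bit (x0 \<and> y0) \<one> \<oplus> bit (x1 \<and> y1) \<one>) \<oplus>
        ((bit (x0 \<and> y1) a \<oplus> bit (x1 \<and> y0) a) \<oplus> bit (x1 \<and> y1) a)"
      using cl by (simp add: a_ac)
    also have "\<dots> = g (x \<otimes>\<^bsub>F4\<^esub> y)"
      unfolding add xy by (simp add: F4_def g_def)
    finally show ?thesis using 1 by simp
  qed
  moreover have "g \<one>\<^bsub>F4\<^esub> = \<one>" by (simp add: g_def F4_def bit_def)
  ultimately have "g \<in> ring_iso F4 R"
    using surj by (intro ring_iso_memI) (auto simp: F4_def)
  then show ?thesis
    using ring_iso_sym[OF cring.axioms(1)[OF fieldE(1)[OF field_F4]]] by (auto simp: is_ring_iso_def)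
qed

text \<open>The size of the maximal ideal divides 4. Size 1 gives five elements and size 2 is
  impossible. Size 4 gives eight elements, with \<open>a - 1\<close> playing the part of
  \<open>x\<close> in the cubic ring.\<close>

lemma iso_order_5_or_8:
  assumes U: "Units R = {\<one>, a, a \<otimes> a, a \<otimes> (a \<otimes> a)}" and a4: "(a \<otimes> a) \<otimes> (a \<otimes> a) = \<one>"
    and ne: "a \<otimes> a \<noteq> \<one>"
  shows "R \<simeq> residue_ring 5 \<or> (\<exists>\<kappa>. R \<simeq> cubic_ring \<kappa>)"
proof -
  have aU: "a \<in> Units R" using U by simp
  have ac: "a \<in> carrier R" using aU by (rule Units_closed)
  have can: "a \<otimes> x = a \<otimes> y \<longleftrightarrow> x = y" if "x \<in> carrier R" "y \<in> carrier R" for x y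
    using that aU by simp
  have a1: "a \<noteq> \<one>" using ne by auto
  have d1: "a \<otimes> a \<noteq> a" using can[of a \<one>] a1 ac by simp
  have d2: "a \<otimes> (a \<otimes> a) \<noteq> a \<otimes> a" using can[of "a \<otimes> a" a] d1 ac by simp
  have d3: "a \<otimes> (a \<otimes> a) \<noteq> a" using can[of "a \<otimes> a" \<one>] ne ac by simp
  have d4: "a \<otimes> (a \<otimes> a) \<noteq> \<one>"
  proof
    assume "a \<otimes> (a \<otimes> a) = \<one>"
    then have "a \<otimes> (a \<otimes> (a \<otimes> a)) = a" using ac by simp
    moreover have "a \<otimes> (a \<otimes> (a \<otimes> a)) = \<one>" using a4 ac by (simp add: m_assoc)
    ultimately show False using a1 by simp
  qed
  have cU: "card (Units R) = 4" unfolding U using a1 ne d1 d2 d3 d4 by auto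
  have "card nonunits dvd 4" using card_nonunits_dvd cU by simp
  moreover have "card nonunits \<le> 4" using card_nonunits_le cU by simp
  then have "card nonunits \<in> {0, 1, 2, 3, 4}" by auto
  ultimately have "card nonunits = 1 \<or> card nonunits = 2 \<or> card nonunits = 4" by auto
  then consider "card nonunits = 1" | "card nonunits = 2" | "card nonunits = 4" by blast
  then show ?thesis
  proof cases
    case 1
    then have "card (carrier R) = 5" unfolding card_carrier cU by simp
    then show ?thesis using card_prime_iso_residue_ring[of 5] by simp
  next
    case 2
    then obtain x y where xy: "nonunits = {x, y}" "x \<noteq> y" by (meson card_2_iff)
    define m where "m = (if x = \<zero> then y else x)"
    have m: "nonunits = {\<zero>, m}" "m \<noteq> \<zero>"
      using xy N.zero_closed by (auto simp: m_def)
    then have mc: "m \<in> carrier R" using nonunits_closed by blast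
    \<comment> \<open>A unit must fix the only nonzero nonunit \<open>m\<close>, so
      \<open>u - 1\<close> annihilates \<open>m\<close> and is no unit. This would inject four units
      into two nonunits.\<close>
    have "u \<ominus> \<one> \<in> nonunits" if u: "u \<in> Units R" for u
    proof (rule ccontr)
      assume "u \<ominus> \<one> \<notin> nonunits"
      then have uu: "u \<ominus> \<one> \<in> Units R"
        using Units_closed[OF u] carrier_eq minus_closed one_closed by blast
      have "u \<otimes> m \<in> nonunits" using m by (intro N.I_l_closed Units_closed[OF u]) simp
      moreover have "u \<otimes> m \<noteq> \<zero>" using unit_mult_eq_zero[OF u mc] m by blast
      ultimately have um: "u \<otimes> m = m" using m by blast
      have "(u \<ominus> \<one>) \<otimes> m = u \<otimes> m \<ominus> m" using u mc Units_closed[OF u] by algebra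
      then have "(u \<ominus> \<one>) \<otimes> m = \<zero>" using um mc by simp
      then show False using unit_mult_eq_zero[OF uu mc] m by blast
    qed
    then have "(\<lambda>u. u \<ominus> \<one>) ` Units R \<subseteq> nonunits" by blast
    moreover have "inj_on (\<lambda>u. u \<ominus> \<one>) (Units R)"
      by (auto simp: inj_on_def a_minus_def Units_closed)
    ultimately have "card (Units R) \<le> card nonunits"
      using finite_nonunits card_inj_on_le by blast
    then show ?thesis using 2 cU by simp
  next
    case 4: 3
    then have eq: "card nonunits = card (Units R)" using cU by simp
    note minus = unit_minus_one[OF eq]
    have twoN: "\<one> \<oplus> \<one> \<in> nonunits" by (rule two_nonunit[OF eq])
    define m where "m = a \<ominus> \<one>"
    define w where "w = a \<otimes> a \<ominus> \<one>"
    define r where "r = a \<otimes> (a \<otimes> a) \<ominus> \<one>"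
    have N: "m \<in> nonunits" "w \<in> nonunits" "r \<in> nonunits"
      using minus U unfolding m_def w_def r_def by auto
    have c: "m \<in> carrier R" "w \<in> carrier R" "r \<in> carrier R"
      using N nonunits_closed by auto
    have nz: "m \<noteq> \<zero>" "w \<noteq> \<zero>" "r \<noteq> \<zero>"
      using a1 ne d4 ac by (auto simp: m_def w_def r_def)
    have nd: "m \<noteq> w" "m \<noteq> r" "w \<noteq> r"
      using d1 d2 d3 ac by (auto simp: m_def w_def r_def a_minus_def)
    have "{\<zero>, m, w, r} = nonunits"
    proof (rule card_subset_eq[OF finite_nonunits])
      show "card {\<zero>, m, w, r} = card nonunits" using nz nd 4 by auto
    qed (use N in auto)
    note Neq = this[symmetric]
    \<comment> \<open>Both identities come from substituting \<open>a = 1 + m\<close> into the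
      powers of \<open>a\<close>.\<close>
    have w_eq: "w = (m \<oplus> m) \<oplus> m \<otimes> m"
      unfolding m_def w_def using ac by algebra
    have r_eq: "r = m \<oplus> w \<oplus> m \<otimes> w"
      unfolding m_def w_def r_def using ac by algebra
    have unit0: "x = \<zero>" if "x \<in> carrier R" "y \<in> nonunits" "(\<one> \<oplus> y) \<otimes> x = \<zero>" for x y
      using unit_mult_eq_zero[OF one_add_nonunit] that by blast
    \<comment> \<open>Since \<open>1 - y\<close> is a unit, multiplication by a nonunit
      \<open>y\<close> fixes only zero.\<close>
    have no_fix: "x = \<zero>" if x: "x \<in> carrier R" "y \<in> nonunits" "y \<otimes> x = x" for x y
    proof (rule unit0[OF x(1)])
      show "\<ominus> y \<in> nonunits" using x by simp
      have yc: "y \<in> carrier R" using x nonunits_closed by blast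
      have "(\<one> \<oplus> \<ominus> y) \<otimes> x = x \<ominus> y \<otimes> x" using x(1) yc by algebra
      then show "(\<one> \<oplus> \<ominus> y) \<otimes> x = \<zero>" using x by simp
    qed
    \<comment> \<open>Among the four nonunits, \<open>m\<close> and \<open>w\<close> are excluded by
      \<open>no_fix\<close>. The value \<open>r\<close> would give \<open>m + w = 0\<close>, but
      this sum is \<open>(3 + m) m\<close> with \<open>3 + m\<close> a unit.\<close>
    have mw: "m \<otimes> w = \<zero>"
    proof (rule ccontr)
      assume nz': "m \<otimes> w \<noteq> \<zero>"
      have "m \<otimes> w \<in> nonunits" using N c by (intro N.I_l_closed)
      moreover have "m \<otimes> w \<noteq> w" using no_fix[of w m] N c nz by blast
      moreover have "m \<otimes> w \<noteq> m" using no_fix[of m w] N c nz m_comm[OF c(1,2)] by auto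
      ultimately have "m \<otimes> w = r" using nz' unfolding Neq by blast
      then have "m \<oplus> w = \<zero>"
        using r_eq c by (metis a_closed add.r_cancel_one' l_zero local.add.right_cancel zero_closed)
      moreover have "m \<oplus> w = (\<one> \<oplus> ((\<one> \<oplus> \<one>) \<oplus> m)) \<otimes> m"
        unfolding w_eq using c by algebra
      ultimately have "m = \<zero>"
        using unit0[of m "(\<one> \<oplus> \<one>) \<oplus> m"] twoN N c by simp
      then show False using nz by simp
    qed
    then have r_eq': "r = m \<oplus> w" using r_eq c by simp
    have three: "x = \<zero>" if "x \<in> carrier R" "(\<one> \<oplus> (\<one> \<oplus> \<one>)) \<otimes> x = \<zero>" for x
      using unit0[OF that(1) twoN that(2)] .
    have "m \<otimes> m \<in> nonunits" using N c by (intro N.I_l_closed)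
    moreover have "m \<otimes> m \<noteq> m" using no_fix[of m m] N c nz by blast
    \<comment> \<open>Here \<open>r = m + w = 3m + m\<^sup>2\<close>, so equality would make
      \<open>3m\<close> zero although 3 is a unit.\<close>
    moreover have "m \<otimes> m \<noteq> r"
    proof
      assume "m \<otimes> m = r"
      then have "m \<otimes> m = m \<oplus> ((m \<oplus> m) \<oplus> m \<otimes> m)" using r_eq' w_eq by simp
      moreover have "m \<oplus> ((m \<oplus> m) \<oplus> m \<otimes> m) = (\<one> \<oplus> (\<one> \<oplus> \<one>)) \<otimes> m \<oplus> m \<otimes> m"
        using c by algebra
      ultimately have "(\<one> \<oplus> (\<one> \<oplus> \<one>)) \<otimes> m = \<zero>"
        using c by (metis add.r_cancel_one' m_closed one_closed a_closed)
      then show False using three c nz by blast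
    qed
    ultimately have mm: "m \<otimes> m = \<zero> \<or> m \<otimes> m = w" unfolding Neq by blast
    have two_m: "(\<one> \<oplus> \<one>) \<otimes> m = m \<oplus> m" using c by algebra
    have two_cases: "\<one> \<oplus> \<one> = \<zero> \<or> \<one> \<oplus> \<one> = m \<or> \<one> \<oplus> \<one> = w \<or> \<one> \<oplus> \<one> = m \<oplus> w"
      using twoN unfolding Neq r_eq' by blast
    have wm: "w \<otimes> m = \<zero>" using mw c by (simp add: m_comm)
    have two_m_cases: "m \<oplus> m = \<zero> \<or> m \<oplus> m = m \<otimes> m"
      unfolding two_m[symmetric] using two_cases by (elim disjE) (use c wm in \<open>simp_all add: l_distr\<close>)
    \<comment> \<open>If \<open>m\<close> squared to zero, both options for
      \<open>m \<oplus> m\<close> would vanish, and with them \<open>w\<close>.\<close>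
    have mm: "m \<otimes> m = w"
    proof (rule ccontr)
      assume "m \<otimes> m \<noteq> w"
      then have "m \<otimes> m = \<zero>" using mm by blast
      then have "w = \<zero>" using w_eq two_m_cases c by auto
      then show False using nz by simp
    qed
    have m2: "m \<oplus> m = \<zero>"
      using w_eq mm c by (metis a_closed add.r_cancel_one')
    have ww: "w \<otimes> w = \<zero>"
    proof -
      have "w \<otimes> w = m \<otimes> (m \<otimes> w)" unfolding mm[symmetric] using c by algebra
      then show ?thesis using mw c by simp
    qed
    have w2: "w \<oplus> w = \<zero>"
    proof -
      have "w \<oplus> w = m \<otimes> (m \<oplus> m)" unfolding mm[symmetric] using c by algebra
      then show ?thesis using m2 c by simp
    qed
    \<comment> \<open>If 2 were \<open>m\<close> or \<open>m + w\<close>, multiplying by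
      \<open>m\<close> would give \<open>w\<close>, although \<open>m \<oplus> m\<close> is
      zero.\<close>
    have two: "\<one> \<oplus> \<one> = \<zero> \<or> \<one> \<oplus> \<one> = w"
    proof (rule ccontr)
      assume "\<not> ?thesis"
      then have "\<one> \<oplus> \<one> = m \<or> \<one> \<oplus> \<one> = m \<oplus> w" using two_cases by blast
      then have "(\<one> \<oplus> \<one>) \<otimes> m = w" by (elim disjE) (use mm wm c in \<open>simp_all add: l_distr\<close>)
      then show False using two_m m2 nz by simp
    qed
    define \<kappa> where "\<kappa> \<longleftrightarrow> \<one> \<oplus> \<one> = w"
    have two': "\<one> \<oplus> \<one> = (if \<kappa> then w else \<zero>)" using two by (auto simp: \<kappa>_def)
    define g where "g = (\<lambda>(x, y, z). bit x \<one> \<oplus> (bit y m \<oplus> bit z w))"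
    have surj: "g ` UNIV = carrier R"
    proof
      \<comment> \<open>The nonunits are the combinations of \<open>m\<close> and \<open>w\<close>
        alone; units are obtained by adding 1, since \<open>u - 1\<close> is always a
        nonunit.\<close>
      have Ng: "\<exists>y z. x = g (False, y, z)" if "x \<in> nonunits" for x
      proof -
        have "\<zero> = g (False, False, False)" "m = g (False, True, False)" "w = g (False, False, True)"
          "r = g (False, True, True)"
          using c r_eq' by (simp_all add: g_def bit_def)
        then show ?thesis using that unfolding Neq by blast
      qed
      show "carrier R \<subseteq> g ` UNIV"
      proof
        fix x assume x: "x \<in> carrier R"
        show "x \<in> g ` UNIV"
        proof (cases "x \<in> Units R")
          case True
          then obtain y z where "x \<ominus> \<one> = g (False, y, z)" using Ng[OF minus] by blast
          then have "\<one> \<oplus> (x \<ominus> \<one>) = g (True, y, z)" using c by (auto simp: g_def bit_def)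
          moreover have "\<one> \<oplus> (x \<ominus> \<one>) = x" using x by algebra
          ultimately show ?thesis by (metis rangeI)
        next
          case False
          then have "x \<in> nonunits" using x by (simp add: nonunits_def)
          then show ?thesis using Ng by blast
        qed
      qed
    qed (use c in \<open>auto simp: g_def bit_closed\<close>)
    have "card (carrier R) = 8" unfolding card_carrier cU 4 by simp
    then have "inj g"
      using surj by (intro eq_card_imp_inj_on) (auto simp flip: UNIV_Times_UNIV)
    then have bij: "bij_betw g (carrier (cubic_ring \<kappa>)) (carrier R)"
      using surj by (simp add: bij_betw_def cubic_ring_def)
    have "g \<in> ring_iso (cubic_ring \<kappa>) R"
    proof (rule ring_iso_memI[OF _ _ _ _ bij])
      have bit_one: "bit p \<one> \<oplus> bit q \<one> = bit (p \<noteq> q) \<one> \<oplus> bit (\<kappa> \<and> p \<and> q) w" for p q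
        using c two' by (auto simp: bit_def)
      fix x y :: "bool \<times> bool \<times> bool"
      obtain x0 x1 x2 y0 y1 y2 where xy: "x = (x0, x1, x2)" "y = (y0, y1, y2)" by (metis surj_pair)
      note cl = bit_closed[OF one_closed, of x0] bit_closed[OF c(1), of x1] bit_closed[OF c(2), of x2]
        bit_closed[OF one_closed, of y0] bit_closed[OF c(1), of y1] bit_closed[OF c(2), of y2]
      have "g x \<oplus> g y = (bit x0 \<one> \<oplus> bit y0 \<one>) \<oplus> ((bit x1 m \<oplus> bit y1 m) \<oplus> (bit x2 w \<oplus> bit y2 w))"
        unfolding xy g_def using cl by (simp add: a_ac)
      also have "\<dots> = (bit (x0 \<noteq> y0) \<one> \<oplus> bit (\<kappa> \<and> x0 \<and> y0) w) \<oplus> (bit (x1 \<noteq> y1) m \<oplus> bit (x2 \<noteq> y2) w)"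
        unfolding bit_one bit_add[OF c(1) m2] bit_add[OF c(2) w2] ..
      also have "\<dots> = bit (x0 \<noteq> y0) \<one> \<oplus> (bit (x1 \<noteq> y1) m \<oplus> (bit (x2 \<noteq> y2) w \<oplus> bit (\<kappa> \<and> x0 \<and> y0) w))"
        using bit_closed c by (simp add: a_ac)
      also have "\<dots> = g (x \<oplus>\<^bsub>cubic_ring \<kappa>\<^esub> y)"
        unfolding bit_add[OF c(2) w2] xy by (simp add: cubic_ring_def g_def)
      finally show "g (x \<oplus>\<^bsub>cubic_ring \<kappa>\<^esub> y) = g x \<oplus> g y" ..
      \<comment> \<open>The summands are grouped by degree, with \<open>m\<close> of degree 1 and
        \<open>w\<close> of degree 2. The last group has degree above 2 and vanishes by
        \<open>mw\<close>, \<open>wm\<close> and \<open>ww\<close>.\<close>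
      have "g x \<otimes> g y = bit x0 \<one> \<otimes> bit y0 \<one> \<oplus> ((bit x0 \<one> \<otimes> bit y1 m \<oplus> bit x1 m \<otimes> bit y0 \<one>) \<oplus>
          (((bit x0 \<one> \<otimes> bit y2 w \<oplus> bit x1 m \<otimes> bit y1 m) \<oplus> bit x2 w \<otimes> bit y0 \<one>) \<oplus>
          (bit x1 m \<otimes> bit y2 w \<oplus> (bit x2 w \<otimes> bit y1 m \<oplus> bit x2 w \<otimes> bit y2 w))))"
        unfolding xy g_def using cl by (simp add: l_distr r_distr a_ac)
      also have "\<dots> = bit (x0 \<and> y0) \<one> \<oplus> ((bit (x0 \<and> y1) m \<oplus> bit (x1 \<and> y0) m) \<oplus>
          ((bit (x0 \<and> y2) w \<oplus> bit (x1 \<and> y1) w) \<oplus> bit (x2 \<and> y0) w))"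
        using c bit_closed by (simp add: bit_mult mm mw wm ww bit_zero)
      also have "\<dots> = g (x \<otimes>\<^bsub>cubic_ring \<kappa>\<^esub> y)"
        unfolding bit_add[OF c(1) m2] bit_add[OF c(2) w2] xy by (simp add: cubic_ring_def g_def)
      finally show "g (x \<otimes>\<^bsub>cubic_ring \<kappa>\<^esub> y) = g x \<otimes> g y" ..
    qed (use c surj in \<open>auto simp: g_def cubic_ring_def bit_def\<close>)
    then have "R \<simeq> cubic_ring \<kappa>"
      using ring_iso_sym[OF cring.axioms(1)[OF cring_cubic_ring]] by (auto simp: is_ring_iso_def)
    then show ?thesis by blast
  qed
qed

end

section \<open>Exceptional rings\<close>

lemma card_nontrivial_sq_RDirProd:
  assumes "monoid B" "Units B = {\<one>\<^bsub>B\<^esub>}"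
  shows "card (nontrivial_sq (RDirProd A B)) = card (nontrivial_sq A)"
proof -
  have "\<one>\<^bsub>B\<^esub> \<otimes>\<^bsub>B\<^esub> \<one>\<^bsub>B\<^esub> = \<one>\<^bsub>B\<^esub>"
    using assms(1) by (simp add: monoid.l_one monoid.one_closed)
  then have "nontrivial_sq (RDirProd A B) = nontrivial_sq A \<times> {\<one>\<^bsub>B\<^esub>}"
    by (auto simp: Units_RDirProd assms(2) RDirProd_simps)
  then show ?thesis by (simp add: card_cartesian_product)
qed

lemma RDirProd_iso:
  assumes "A \<simeq> A'" "B \<simeq> B'"
  shows "RDirProd A B \<simeq> RDirProd A' B'"
proof -
  obtain f g where "f \<in> ring_iso A A'" "g \<in> ring_iso B B'"
    using assms by (auto simp: is_ring_iso_def)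
  from RDirProd_iso6[OF this] show ?thesis by (auto simp: is_ring_iso_def)
qed

lemma ring_iso_card_nontrivial_sq_residue_ring_2:
  assumes "ring R" "R \<simeq> RDirProd A (residue_ring 2)"
  shows "card (nontrivial_sq R) = card (nontrivial_sq A)"
proof -
  interpret Z2: cring "residue_ring 2" by (rule cring_residue_ring) simp
  show ?thesis
    using ring_iso_card_nontrivial_sq[OF assms]
      card_nontrivial_sq_RDirProd[OF Z2.monoid_axioms Units_residue_ring_2, of A] by simp
qed

lemma ring_iso_RDirProd_trans: "R \<simeq> RDirProd A B \<Longrightarrow> A \<simeq> A' \<Longrightarrow> R \<simeq> RDirProd A' B"
  by (rule ring_iso_trans[OF _ RDirProd_iso[OF _ ring_iso_refl]])

text \<open>The factor \<open>residue_ring 2\<close> has only the trivial unit, so the count is that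
  of the other factor, which is computed in its model.\<close>

lemma exceptional_ring_card:
  assumes "ring R" "exceptional_ring R"
  shows "card (nontrivial_sq R) = 2"
  using assms(2) unfolding exceptional_ring_def
proof (elim disjE)
  assume "R \<simeq> RDirProd F4 (residue_ring 2)"
  from ring_iso_card_nontrivial_sq_residue_ring_2[OF assms(1) this]
  show ?thesis by (simp only: card_nontrivial_sq_F4)
next
  assume "R \<simeq> RDirProd (residue_ring 5) (residue_ring 2)"
  from ring_iso_card_nontrivial_sq_residue_ring_2[OF assms(1) this]
  show ?thesis by (simp only: card_nontrivial_sq_residue_ring_5)
next
  assume "R \<simeq> RDirProd Z2_X_mod_X3 (residue_ring 2)"
  from ring_iso_card_nontrivial_sq_residue_ring_2[OF assms(1) ring_iso_RDirProd_trans[OF this Z2_X_mod_X3_iso(1)]]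
  show ?thesis by (simp only: card_nontrivial_sq_cubic_ring)
next
  assume "R \<simeq> RDirProd Z4_X_mod_2X_X2_minus_2 (residue_ring 2)"
  from ring_iso_card_nontrivial_sq_residue_ring_2[OF assms(1)
      ring_iso_RDirProd_trans[OF this Z4_X_mod_2X_X2_minus_2_iso(1)]]
  show ?thesis by (simp only: card_nontrivial_sq_cubic_ring)
qed

lemma exceptional_ring_trans: "R \<simeq> S \<Longrightarrow> exceptional_ring S \<Longrightarrow> exceptional_ring R"
  unfolding exceptional_ring_def by (elim disjE) (auto intro: ring_iso_trans)

text \<open>Having just two units with nontrivial square leaves no room for a second unit in
  \<open>B\<close> and makes the unit group of \<open>A\<close> cyclic of order 3 or 4.\<close>

lemma exceptional_ring_RDirProd_left:
  assumes "finite_local_ring A" "finite_local_ring B"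
    and two: "card (nontrivial_sq (RDirProd A B)) = 2"
    and a: "a \<in> Units A" "a \<otimes>\<^bsub>A\<^esub> a \<noteq> \<one>\<^bsub>A\<^esub>"
  shows "exceptional_ring (RDirProd A B)"
proof -
  interpret A: finite_local_ring A by fact
  interpret B: finite_local_ring B by fact
  let ?W = "nontrivial_sq (RDirProd A B)"
  have W: "(u, v) \<in> ?W" if "u \<in> Units A" "u \<otimes>\<^bsub>A\<^esub> u \<noteq> \<one>\<^bsub>A\<^esub>" "v \<in> Units B" for u v
    using that by (simp add: Units_RDirProd RDirProd_simps)
  define b where "b = inv\<^bsub>A\<^esub> a"
  have b: "b \<in> Units A" "a \<otimes>\<^bsub>A\<^esub> b = \<one>\<^bsub>A\<^esub>" "b \<otimes>\<^bsub>A\<^esub> a = \<one>\<^bsub>A\<^esub>" using a by (auto simp: b_def)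
  have ac: "a \<in> carrier A" "b \<in> carrier A" using a b by auto
  have ab: "a \<noteq> b" using a b by auto
  have bb: "b \<otimes>\<^bsub>A\<^esub> b \<noteq> \<one>\<^bsub>A\<^esub>"
    using A.units_mult_eq_one_iff(1)[OF b(1) b(1)] A.units_mult_eq_one_iff(1)[OF b(1) a(1)] b ab by auto
  have "finite ?W" by (rule ccontr) (use two in simp)
  have UB: "Units B = {\<one>\<^bsub>B\<^esub>}"
  proof (rule ccontr)
    assume "Units B \<noteq> {\<one>\<^bsub>B\<^esub>}"
    then obtain v where v: "v \<in> Units B" "v \<noteq> \<one>\<^bsub>B\<^esub>" using B.Units_one_closed by blast
    \<comment> \<open>A unit \<open>v\<close> other than 1 would produce a third element with
      nontrivial square, since \<open>a\<close> already guarantees this whatever the second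
      component is.\<close>
    have sub: "{(a, \<one>\<^bsub>B\<^esub>), (b, \<one>\<^bsub>B\<^esub>), (a, v)} \<subseteq> ?W"
      using W a b bb v B.Units_one_closed by blast
    have "card {(a, \<one>\<^bsub>B\<^esub>), (b, \<one>\<^bsub>B\<^esub>), (a, v)} \<le> 2"
      using card_mono[OF \<open>finite ?W\<close> sub] unfolding two .
    then show False using ab v by auto
  qed
  have "card (nontrivial_sq A) = 2"
    using two unfolding card_nontrivial_sq_RDirProd[OF B.monoid_axioms UB] .
  moreover have "{a, b} \<subseteq> nontrivial_sq A" using a b bb by auto
  moreover have "finite (nontrivial_sq A)" using A.finite_Units by simp
  ultimately have UA: "nontrivial_sq A = {a, b}"
    using card_subset_eq[of "nontrivial_sq A" "{a, b}"] ab by simp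
  have canc: "b \<otimes>\<^bsub>A\<^esub> x = b \<otimes>\<^bsub>A\<^esub> y \<longleftrightarrow> x = y" if "x \<in> carrier A" "y \<in> carrier A" for x y
    using that b by simp
  have units: "z \<in> {\<one>\<^bsub>A\<^esub>, b, b \<otimes>\<^bsub>A\<^esub> b, a}" if z: "z \<in> Units A" for z
  proof (cases "z \<otimes>\<^bsub>A\<^esub> z = \<one>\<^bsub>A\<^esub>")
    case False
    then have "z \<in> nontrivial_sq A" using z by simp
    then show ?thesis using UA by blast
  next
    case True
    have zc: "z \<in> carrier A" using z by auto
    \<comment> \<open>Multiplying \<open>a\<close> by a unit of square 1 keeps the square of
      \<open>a\<close>, so the product is \<open>a\<close> or \<open>b\<close>. Hence
      \<open>z\<close> is 1 or the square of \<open>b\<close>.\<close>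
    have "(a \<otimes>\<^bsub>A\<^esub> z) \<otimes>\<^bsub>A\<^esub> (a \<otimes>\<^bsub>A\<^esub> z) = (a \<otimes>\<^bsub>A\<^esub> a) \<otimes>\<^bsub>A\<^esub> (z \<otimes>\<^bsub>A\<^esub> z)"
      using ac zc by (simp add: A.m_ac)
    then have "a \<otimes>\<^bsub>A\<^esub> z \<in> nontrivial_sq A" using True a z ac by simp
    then have az: "a \<otimes>\<^bsub>A\<^esub> z = a \<or> a \<otimes>\<^bsub>A\<^esub> z = b" using UA by blast
    have "z = b \<otimes>\<^bsub>A\<^esub> (a \<otimes>\<^bsub>A\<^esub> z)"
      using b ac zc by (simp flip: A.m_assoc)
    then have "z = b \<otimes>\<^bsub>A\<^esub> a \<or> z = b \<otimes>\<^bsub>A\<^esub> b" using az by auto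
    then show ?thesis using b by auto
  qed
  have bbU: "b \<otimes>\<^bsub>A\<^esub> b \<in> Units A" using b by simp
  \<comment> \<open>If the fourth power of \<open>b\<close> is 1, then \<open>a\<close> is the cube
    of \<open>b\<close> and the group has order 4. Otherwise the square of \<open>b\<close> is
    itself nontrivial, hence equal to \<open>a\<close>, and the order is 3.\<close>
  have A: "A \<simeq> F4 \<or> A \<simeq> residue_ring 5 \<or> (\<exists>\<kappa>. A \<simeq> cubic_ring \<kappa>)"
  proof (cases "(b \<otimes>\<^bsub>A\<^esub> b) \<otimes>\<^bsub>A\<^esub> (b \<otimes>\<^bsub>A\<^esub> b) = \<one>\<^bsub>A\<^esub>")
    case True
    then have "b \<otimes>\<^bsub>A\<^esub> (b \<otimes>\<^bsub>A\<^esub> (b \<otimes>\<^bsub>A\<^esub> b)) = b \<otimes>\<^bsub>A\<^esub> a" using b ac by (simp add: A.m_assoc)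
    then have "b \<otimes>\<^bsub>A\<^esub> (b \<otimes>\<^bsub>A\<^esub> b) = a" using canc[of "b \<otimes>\<^bsub>A\<^esub> (b \<otimes>\<^bsub>A\<^esub> b)" a] ac by simp
    then have "Units A = {\<one>\<^bsub>A\<^esub>, b, b \<otimes>\<^bsub>A\<^esub> b, b \<otimes>\<^bsub>A\<^esub> (b \<otimes>\<^bsub>A\<^esub> b)}"
      using units a(1) b(1) bbU by auto
    then show ?thesis using A.iso_order_5_or_8[OF _ True bb] by blast
  next
    case False
    then have "b \<otimes>\<^bsub>A\<^esub> b \<in> nontrivial_sq A" using bbU by simp
    then have "b \<otimes>\<^bsub>A\<^esub> b = a \<or> b \<otimes>\<^bsub>A\<^esub> b = b" using UA by blast
    moreover have "b \<otimes>\<^bsub>A\<^esub> b \<noteq> b" using canc[of b "\<one>\<^bsub>A\<^esub>"] ac bb by auto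
    ultimately have bba: "b \<otimes>\<^bsub>A\<^esub> b = a" by blast
    then have "Units A = {\<one>\<^bsub>A\<^esub>, b, b \<otimes>\<^bsub>A\<^esub> b}"
      using units a(1) b(1) by auto
    moreover have "b \<otimes>\<^bsub>A\<^esub> (b \<otimes>\<^bsub>A\<^esub> b) = \<one>\<^bsub>A\<^esub>" using bba b by simp
    ultimately show ?thesis using A.iso_F4[OF _ _ bb] by blast
  qed
  have "A \<simeq> Z2_X_mod_X3 \<or> A \<simeq> Z4_X_mod_2X_X2_minus_2" if "A \<simeq> cubic_ring \<kappa>" for \<kappa>
  proof (cases \<kappa>)
    case True
    then have "A \<simeq> cubic_ring True" using that by simp
    from ring_iso_trans[OF this Z4_X_mod_2X_X2_minus_2_iso(2)] show ?thesis ..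
  next
    case False
    then have "A \<simeq> cubic_ring False" using that by simp
    from ring_iso_trans[OF this Z2_X_mod_X3_iso(2)] show ?thesis ..
  qed
  then have "A \<simeq> F4 \<or> A \<simeq> residue_ring 5 \<or> A \<simeq> Z2_X_mod_X3 \<or> A \<simeq> Z4_X_mod_2X_X2_minus_2"
    using A by blast
  then show ?thesis
    unfolding exceptional_ring_def
    by (elim disjE) (simp_all add: RDirProd_iso[OF _ B.iso_residue_ring_2[OF UB]])
qed

text \<open>A pair with nontrivial square has such a component in one of the factors. If only the
  second factor qualifies, the factors are swapped.\<close>

lemma exceptional_ring_RDirProd:
  assumes "finite_local_ring A" "finite_local_ring B"
    and two: "card (nontrivial_sq (RDirProd A B)) = 2"
  shows "exceptional_ring (RDirProd A B)"
proof -
  interpret A: finite_local_ring A by fact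
  interpret B: finite_local_ring B by fact
  have swap: "RDirProd A B \<simeq> RDirProd B A"
    using RDirProd_iso1 by (auto simp: is_ring_iso_def)
  have "ring (RDirProd A B)"
    using RDirProd_ring A.ring_axioms B.ring_axioms by blast
  from ring_iso_card_nontrivial_sq[OF this swap] have two': "card (nontrivial_sq (RDirProd B A)) = 2"
    using two by simp
  have "nontrivial_sq (RDirProd A B) \<noteq> {}"
  proof
    assume empty: "nontrivial_sq (RDirProd A B) = {}"
    show False using two unfolding empty by simp
  qed
  then obtain u v where "u \<in> Units A" "v \<in> Units B"
    "u \<otimes>\<^bsub>A\<^esub> u \<noteq> \<one>\<^bsub>A\<^esub> \<or> v \<otimes>\<^bsub>B\<^esub> v \<noteq> \<one>\<^bsub>B\<^esub>"
    by (auto simp: Units_RDirProd RDirProd_simps)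
  then show "exceptional_ring (RDirProd A B)"
    using exceptional_ring_RDirProd_left[OF assms] exceptional_ring_trans[OF swap]
      exceptional_ring_RDirProd_left[OF assms(2,1) two'] by blast
qed

theorem theorem4p11:
  fixes R :: "('a, 'm) ring_scheme"
    and Rs :: "('b, 'k) ring_scheme list"
    and n :: nat
  assumes "cring R"
    and "finite (carrier R)"
    and "\<not> local_ring R"
    and "n \<ge> 2"
    and "length Rs = n"
    and "\<forall>S \<in> set Rs. local_ring S"
    and "R \<simeq> RDirProd_list Rs"
    and "units_sq_not_one R \<noteq> {}"
  shows "(n \<ge> 3 \<longrightarrow>
            int (sdim (clean_graph2 R)) = (2 ^ n - 1) * int (card (Units R)) - 2 ^ n)
       \<and> (n = 2 \<and> exceptional_ring R \<longrightarrow>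
            int (sdim (clean_graph2 R)) = 3 * int (card (Units R)) - 5)
       \<and> (n = 2 \<and> \<not> exceptional_ring R \<longrightarrow>
            int (sdim (clean_graph2 R)) = 3 * int (card (Units R)) - 6)"
proof -
  interpret R: cring R by fact
  have fin: "finite (carrier (RDirProd_list Rs))"
    using ring_iso_finite[OF R.ring_axioms assms(7)] assms(2) by blast
  note list = card_idempotents_RDirProd_list[OF assms(6) fin]
  have idem: "card (idempotents R) = 2 ^ n"
    using ring_iso_card_idempotents[OF R.ring_axioms assms(7)] list assms(5) by simp
  have "(2::nat) ^ 2 \<le> 2 ^ n" using assms(4) by (intro power_increasing) auto
  then interpret clean_ring R
    by unfold_locales (use assms idem in auto)
  have "int (sdim (clean_graph2 R)) = (2 ^ n - 1) * int (card (Units R)) - 2 ^ n" if "n \<ge> 3"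
  proof -
    \<comment> \<open>Three factors give at least eight idempotents, which meets the strict bound of
      the large case.\<close>
    have "(2::nat) ^ 3 \<le> 2 ^ n" using that by (intro power_increasing) auto
    then show ?thesis using sdim_clean_graph2_large unfolding idem by simp
  qed
  moreover have "exceptional_ring R \<longleftrightarrow> card (units_sq_not_one R) = 2" if n: "n = 2"
  proof
    show "card (units_sq_not_one R) = 2" if "exceptional_ring R"
      using exceptional_ring_card[OF R.ring_axioms that] units_sq_not_one_eq[OF R.monoid_axioms] by simp
    assume two: "card (units_sq_not_one R) = 2"
    obtain A B where Rs: "Rs = [A, B]"
      using assms(5) n by (auto simp: length_Suc_conv numeral_2_eq_2)
    have loc: "finite_local_ring A" "finite_local_ring B"
      using assms(6) list unfolding Rs finite_local_ring_def finite_local_ring_axioms_def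
      by (auto simp: local_ring_def)
    have "ring B" by (rule cring.axioms(1)[OF finite_local_ring.axioms(1)[OF loc(2)]])
    \<comment> \<open>The product of a two-element list is nested with a one-element product inside,
      which must be collapsed to reach the binary product.\<close>
    have "RDirProd_list [B] \<simeq> B"
      using RDirProd_list_iso3 ring_iso_sym[OF \<open>ring B\<close>] by (auto simp: is_ring_iso_def)
    then have B: "RDirProd A (RDirProd_list [B]) \<simeq> RDirProd A B"
      by (intro RDirProd_iso ring_iso_refl)
    have "RDirProd_list [A, B] \<simeq> RDirProd A (RDirProd_list [B])"
      using RDirProd_list_iso2 by (auto simp: is_ring_iso_def)
    from ring_iso_trans[OF assms(7)[unfolded Rs] ring_iso_trans[OF this B]]
    have iso: "R \<simeq> RDirProd A B" .
    have "card (nontrivial_sq (RDirProd A B)) = 2"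
      using ring_iso_card_nontrivial_sq[OF R.ring_axioms iso] two units_sq_not_one_eq[OF R.monoid_axioms] by simp
    then show "exceptional_ring R"
      using exceptional_ring_RDirProd[OF loc] exceptional_ring_trans[OF iso] by blast
  qed
  ultimately show ?thesis
    using sdim_clean_graph2_four_small sdim_clean_graph2_four_large idem by auto
qed

end
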